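(* Let $\mathbb{K}$ be a field of characteristic zero, $\mathbb{F}$ its algebraic closure, $V$ a finite dimensional $\mathbb{K}$-vector space and $\mathfrak{a}_0$ a Lie subalgebra of $\mathfrak{gl}_{\mathbb{K}}(V)$. The maximal effective prolongation of type $\mathfrak{a}_0$ of $V$ is infinite dimensional if and only if $\mathbb{F}\otimes_{\mathbb{K}}\mathfrak{a}_0$ contains an element of rank one on $V_{(\mathbb{F})}=\mathbb{F}\otimes_{\mathbb{K}}V$.
   Context: $V$ is considered as an abelian Lie algebra whose elements have degree $-1$. The maximal effective prolongation of type $\mathfrak{a}_0$ of $V$ is the graded Lie algebra $\mathfrak{a}=V\oplus\mathfrak{a}_0\oplus\sum_{p\ge1}\mathfrak{a}_p$, where $\mathfrak{a}_p$ (for $p\ge1$) is the space of symmetric $(p+1)$-linear maps $\xi:V^{p+1}\to V$ such that, for all $v_1,\dots,v_p\in V$, the endomorphism $v\mapsto\xi(v_1,\dots,v_p,v)$ belongs to $\mathfrak{a}_0$. *)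

theory Defs
  imports
    "HOL-Algebra.Algebraic_Closure_Type"
    "HOL-Algebra.Free_Abelian_Groups"
    "HOL-Library.Function_Algebras"
    "HOL-Library.Product_Plus"
    "Jordan_Normal_Form.Missing_VectorSpace"
begin

text \<open>A vector space over a field \<open>'k\<close> is a type \<open>'v\<close> with a scalar multiplication
  \<open>s :: 'k \<Rightarrow> 'v \<Rightarrow> 'v\<close> satisfying \<^term>\<open>vector_space s\<close>; its subspaces are sets. Addition of maps
  is pointwise (\<^theory>\<open>HOL-Library.Function_Algebras\<close>).\<close>

definition scale_fun :: "('k \<Rightarrow> 'v \<Rightarrow> 'v) \<Rightarrow> 'k \<Rightarrow> ('b \<Rightarrow> 'v) \<Rightarrow> ('b \<Rightarrow> 'v)"
  where "scale_fun s c A = (\<lambda>x. s c (A x))"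

definition gl :: "('k::field \<Rightarrow> 'v::ab_group_add \<Rightarrow> 'v) \<Rightarrow> ('v \<Rightarrow> 'v) set"
  where "gl s = {A. Vector_Spaces.linear s s A}"

definition lie_subalgebra_gl ::
    "('k::field \<Rightarrow> 'v::ab_group_add \<Rightarrow> 'v) \<Rightarrow> ('v \<Rightarrow> 'v) set \<Rightarrow> bool"
  where "lie_subalgebra_gl s L \<longleftrightarrow>
    L \<subseteq> gl s \<and>
    Modules.module.subspace (scale_fun s) L \<and>
    (\<forall>A\<in>L. \<forall>B\<in>L. (A \<circ> B) - (B \<circ> A) \<in> L)"

definition finite_dimensional ::
    "('k::field \<Rightarrow> 'v::ab_group_add \<Rightarrow> 'v) \<Rightarrow> 'v set \<Rightarrow> bool"
  where "finite_dimensional s W \<longleftrightarrow> (\<exists>B. finite B \<and> Modules.module.span s B = W)"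

text \<open>A map \<open>V\<^sup>p\<^sup>+\<^sup>1 \<rightarrow> V\<close> is a function on lists that is \<open>0\<close> on lists of any length other
  than \<open>p + 1\<close>, so that distinct elements of the set are distinct maps.\<close>

definition prolong_component ::
    "('k::field \<Rightarrow> 'v::ab_group_add \<Rightarrow> 'v) \<Rightarrow> ('v \<Rightarrow> 'v) set \<Rightarrow> nat \<Rightarrow> ('v list \<Rightarrow> 'v) set"
  where "prolong_component s L p = {\<xi>.
    (\<forall>xs. length xs \<noteq> p + 1 \<longrightarrow> \<xi> xs = 0) \<and>
    (\<forall>xs i. length xs = p + 1 \<and> i < p + 1 \<longrightarrow> Vector_Spaces.linear s s (\<lambda>v. \<xi> (xs[i := v]))) \<and>
    (\<forall>xs ys. length xs = p + 1 \<and> mset xs = mset ys \<longrightarrow> \<xi> xs = \<xi> ys) \<and>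
    (\<forall>vs. length vs = p \<longrightarrow> (\<lambda>v. \<xi> (vs @ [v])) \<in> L)}"

text \<open>The direct sum \<open>V \<oplus> \<aa>\<^sub>0 \<oplus> \<Sum>\<^bsub>p\<ge>1\<^esub> \<aa>\<^sub>p\<close>. An element is \<open>(v, A, \<omega>)\<close>, where \<open>\<omega> p\<close> is the component
  of degree \<open>p\<close>; the slot \<open>\<omega> 0\<close> is not used, since the component of degree \<open>0\<close> is \<open>A\<close>. Only the
  underlying graded vector space is recorded, as the dimension does not involve the bracket.\<close>

definition max_effective_prolongation ::
    "('k::field \<Rightarrow> 'v::ab_group_add \<Rightarrow> 'v) \<Rightarrow> ('v \<Rightarrow> 'v) set
      \<Rightarrow> ('v \<times> ('v \<Rightarrow> 'v) \<times> (nat \<Rightarrow> 'v list \<Rightarrow> 'v)) set"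
  where "max_effective_prolongation s L = {(v, A, \<omega>).
    A \<in> L \<and> \<omega> 0 = 0 \<and> (\<forall>p\<ge>1. \<omega> p \<in> prolong_component s L p) \<and> finite {p. \<omega> p \<noteq> 0}}"

definition prolongation_scale ::
    "('k \<Rightarrow> 'v \<Rightarrow> 'v) \<Rightarrow> 'k \<Rightarrow> 'v \<times> ('v \<Rightarrow> 'v) \<times> (nat \<Rightarrow> 'v list \<Rightarrow> 'v)
      \<Rightarrow> 'v \<times> ('v \<Rightarrow> 'v) \<times> (nat \<Rightarrow> 'v list \<Rightarrow> 'v)"
  where "prolongation_scale s c = (\<lambda>(v, A, \<omega>). (s c v, scale_fun s c A, scale_fun (scale_fun s) c \<omega>))"

text \<open>The tensor product over \<open>'k\<close> of a subspace \<open>U\<close> and a subspace \<open>W\<close> (of possibly different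
  spaces): the free abelian group on \<open>U \<times> W\<close> modulo the bilinearity relations. Its elements are
  cosets, and \<^term>\<open>frag_of (u, w)\<close> represents the pure tensor of \<open>u\<close> and \<open>w\<close>.\<close>

definition tensor_relations ::
    "('k \<Rightarrow> 'a::ab_group_add \<Rightarrow> 'a) \<Rightarrow> 'a set \<Rightarrow> ('k \<Rightarrow> 'b::ab_group_add \<Rightarrow> 'b) \<Rightarrow> 'b set
      \<Rightarrow> ('a \<times> 'b \<Rightarrow>\<^sub>0 int) set"
  where "tensor_relations sU U sW W =
    {frag_of (u + u', w) - frag_of (u, w) - frag_of (u', w) | u u' w. u \<in> U \<and> u' \<in> U \<and> w \<in> W} \<union>
    {frag_of (u, w + w') - frag_of (u, w) - frag_of (u, w') | u w w'. u \<in> U \<and> w \<in> W \<and> w' \<in> W} \<union>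
    {frag_of (sU c u, w) - frag_of (u, sW c w) | c u w. u \<in> U \<and> w \<in> W}"

definition tensor_null ::
    "('k \<Rightarrow> 'a::ab_group_add \<Rightarrow> 'a) \<Rightarrow> 'a set \<Rightarrow> ('k \<Rightarrow> 'b::ab_group_add \<Rightarrow> 'b) \<Rightarrow> 'b set
      \<Rightarrow> ('a \<times> 'b \<Rightarrow>\<^sub>0 int) set"
  where "tensor_null sU U sW W =
    generate (free_Abelian_group (U \<times> W)) (tensor_relations sU U sW W)"

definition tensor_product ::
    "('k \<Rightarrow> 'a::ab_group_add \<Rightarrow> 'a) \<Rightarrow> 'a set \<Rightarrow> ('k \<Rightarrow> 'b::ab_group_add \<Rightarrow> 'b) \<Rightarrow> 'b set
      \<Rightarrow> ('a \<times> 'b \<Rightarrow>\<^sub>0 int) set monoid"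
  where "tensor_product sU U sW W =
    free_Abelian_group (U \<times> W) Mod tensor_null sU U sW W"

definition ac_scale :: "'k::field \<Rightarrow> 'k alg_closure \<Rightarrow> 'k alg_closure"
  where "ac_scale c f = to_ac c * f"

text \<open>The class in \<open>\<bbbF> \<otimes> W\<close> of a formal sum of pairs \<open>(f, w)\<close>, where \<open>\<bbbF>\<close> is the algebraic closure.\<close>

definition ac_class ::
    "('k::field \<Rightarrow> 'b::ab_group_add \<Rightarrow> 'b) \<Rightarrow> 'b set
      \<Rightarrow> ('k alg_closure \<times> 'b \<Rightarrow>\<^sub>0 int) \<Rightarrow> ('k alg_closure \<times> 'b \<Rightarrow>\<^sub>0 int) set"
  where "ac_class s W x =
    tensor_null ac_scale UNIV s W #>\<^bsub>free_Abelian_group (UNIV \<times> W)\<^esub> x"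

text \<open>\<open>\<bbbF> \<otimes> W\<close> as an \<open>\<bbbF>\<close>-vector space, with \<open>a \<odot> (f \<otimes> w) = a f \<otimes> w\<close>. The operations on cosets are
  computed on all representatives; the union is over equal cosets. The fields \<open>mult\<close> and \<open>one\<close>,
  which the module record inherits from rings, carry no meaning.\<close>

definition ac_extension ::
    "('k::field \<Rightarrow> 'b::ab_group_add \<Rightarrow> 'b) \<Rightarrow> 'b set
      \<Rightarrow> ('k alg_closure, ('k alg_closure \<times> 'b \<Rightarrow>\<^sub>0 int) set) module"
  where "ac_extension s W =
    \<lparr>carrier = carrier (tensor_product ac_scale UNIV s W),
     monoid.mult = undefined,
     monoid.one = undefined,
     ring.zero = \<one>\<^bsub>tensor_product ac_scale UNIV s W\<^esub>,
     add = monoid.mult (tensor_product ac_scale UNIV s W),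
     module.smult = (\<lambda>a \<tau>. \<Union>x\<in>\<tau>. ac_class s W (frag_extend (\<lambda>(f, w). frag_of (a * f, w)) x))\<rparr>"

text \<open>The action of \<open>\<bbbF> \<otimes> L\<close> on \<open>\<bbbF> \<otimes> V\<close> for \<open>L \<subseteq> \<gg>\<ll>(V)\<close>: \<open>(f \<otimes> A) (g \<otimes> v) = f g \<otimes> A v\<close>.\<close>

definition ac_action ::
    "('k::field \<Rightarrow> 'v::ab_group_add \<Rightarrow> 'v)
      \<Rightarrow> ('k alg_closure \<times> ('v \<Rightarrow> 'v) \<Rightarrow>\<^sub>0 int) set
      \<Rightarrow> ('k alg_closure \<times> 'v \<Rightarrow>\<^sub>0 int) set \<Rightarrow> ('k alg_closure \<times> 'v \<Rightarrow>\<^sub>0 int) set"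
  where "ac_action s \<theta> \<tau> = (\<Union>x\<in>\<theta>. \<Union>y\<in>\<tau>. ac_class s UNIV
    (frag_extend (\<lambda>(f, A). frag_extend (\<lambda>(g, v). frag_of (f * g, A v)) y) x))"

definition rank_on ::
    "('f::field, 'm) module \<Rightarrow> ('m \<Rightarrow> 'm) \<Rightarrow> nat"
  where "rank_on M T = vectorspace.dim ring_of_type_algebra (M\<lparr>carrier := T ` carrier M\<rparr>)"

end

theory Submission
  imports Defs
begin

text \<open>If \<open>\<bbbF> \<otimes> \<aa>\<^sub>0\<close> contains a map \<open>\<alpha> \<otimes> w\<close> of rank one, then \<open>\<alpha>\<close> and \<open>w\<close> give the symmetric maps
  \<open>\<alpha>\<^sup>p\<^sup>+\<^sup>1 \<otimes> w\<close> over \<open>\<bbbF>\<close>; applying a \<open>\<bbbK>\<close>-linear functional \<open>\<bbbF> \<rightarrow> \<bbbK>\<close> to the coefficients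
  yields nonzero elements of \<open>\<aa>\<^sub>p\<close> for every \<open>p\<close>.

  Conversely, if infinitely many \<open>\<aa>\<^sub>p\<close> are nonzero, then the prolongations of \<open>\<bbbF> \<otimes> \<aa>\<^sub>0\<close> are nonzero in
  every degree, and contraction with the basis vectors makes them a system of finite dimensional spaces
  with commuting operators of degree \<open>-1\<close>. In a subsystem that is minimal among those that are nonzero
  in every degree, a linear combination of the operators is either zero or onto, because its kernel
  and its image are subsystems. A nonzero operator is then invertible in high degree, the quotient of
  two operators has an eigenvalue there, and so all operators are proportional on the minimal subsystem.
  In degree one this gives a map of rank one in \<open>\<bbbF> \<otimes> \<aa>\<^sub>0\<close>. The argument replaces the usual
  appeal to the Nullstellensatz.\<close>

section \<open>Finite dimensional subspaces and eigenvectors\<close>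

context vector_space
begin

text \<open>The ambient space may have infinite dimension, so finiteness comes from
  \<open>B\<close>. A basis of \<open>U\<close> together with one vector of \<open>W\<close> outside
  \<open>U\<close> is still independent and extends to a basis of \<open>W\<close>.\<close>

lemma dim_less_of_psubset:
  assumes U: "subspace U" and UW: "U \<subset> W" and W: "W \<subseteq> span B" and B: "finite B"
  shows "dim U < dim W"
proof -
  obtain A where A: "A \<subseteq> U" "independent A" "U \<subseteq> span A" "card A = dim U"
    using basis_exists by blast
  obtain w where w: "w \<in> W" "w \<notin> U" using UW by blast
  have "w \<notin> span A" using span_minimal[OF A(1) U] w(2) by blast
  then have ind: "independent (insert w A)" using A(2) by (rule independent_insertI)
  have "insert w A \<subseteq> W" using w A(1) UW by blast
  from maximal_independent_subset_extend[OF this ind]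
  obtain C where C: "insert w A \<subseteq> C" "C \<subseteq> W" "independent C" "W \<subseteq> span C" by blast
  have "finite C" using independent_span_bound[OF B C(3)] C(2) W by blast
  moreover have "w \<notin> A" using w(2) A(1) by blast
  ultimately have "card A < card C" using C(1) by (metis insert_subset psubsetI psubset_card_mono)
  then show ?thesis using A(4) basis_card_eq_dim[OF C(2,4,3)] by simp
qed

lemma dim_inj_image:
  assumes f: "Vector_Spaces.linear scale scale f" and W: "subspace W" and inj: "inj_on f W"
  shows "dim (f ` W) = dim W"
proof -
  interpret P: vector_space_pair scale scale by unfold_locales
  obtain A where A: "A \<subseteq> W" "independent A" "W \<subseteq> span A" "card A = dim W"
    using basis_exists by blast
  have sp: "span A = W" using span_minimal[OF A(1) W] A(3) by blast
  have i: "independent (f ` A)"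
    using P.linear_independent_injective_image[OF f A(2)] inj sp by simp
  have s: "span (f ` A) = f ` W"
    using P.linear_span_image[OF f, of A] sp by simp
  have "dim (f ` W) = card (f ` A)"
    using dim_span_eq_card_independent[OF i] s by simp
  also have "\<dots> = card A" using inj A(1) by (meson card_image inj_on_subset)
  finally show ?thesis using A(4) by simp
qed

text \<open>A linear right inverse \<open>g\<close> of \<open>f\<close> embeds \<open>W\<close> into
  \<open>U\<close>. Equal dimensions make this embedding onto, so \<open>x = g w\<close> for some
  \<open>w\<close>, and \<open>w = f x = 0\<close>.\<close>

lemma linear_surj_imp_inj_on:
  assumes f: "Vector_Spaces.linear scale scale f" and U: "subspace U" and onto: "f ` U = W"
    and UB: "U \<subseteq> span B" and B: "finite B" and dims: "dim U = dim W"
    and x: "x \<in> U" "f x = 0"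
  shows "x = 0"
proof -
  interpret P: vector_space_pair scale scale by unfold_locales
  obtain g where g: "g ` UNIV \<subseteq> U" "Vector_Spaces.linear scale scale g" "\<forall>v\<in>f ` U. f (g v) = v"
    using P.linear_exists_right_inverse_on[OF f U] by blast
  have W: "subspace W" using P.linear_subspace_image[OF f U] onto by simp
  have "inj_on g W" using g(3) onto by (metis inj_onI)
  then have d: "dim (g ` W) = dim U" using dim_inj_image[OF g(2) W] dims by simp
  have sg: "subspace (g ` W)" by (rule P.linear_subspace_image[OF g(2) W])
  have "g ` W \<subseteq> U" using g(1) by (meson image_mono order_trans subset_UNIV)
  moreover have "\<not> g ` W \<subset> U"
    using dim_less_of_psubset[OF sg _ UB B] d by (metis less_irrefl)
  ultimately have "g ` W = U" by (simp add: psubset_eq)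
  then obtain w where w: "w \<in> W" "x = g w" using x(1) by (metis imageE)
  have "w = 0" using g(3) w onto x(2) by auto
  then show ?thesis using w(2) P.linear_0[OF g(2)] by simp
qed

end

text \<open>Among the first \<open>card B + 1\<close> vectors there is a linear relation, whose
  coefficients form the polynomial. Dependence is a property of sets and does not see repetitions,
  so two equal vectors \<open>f i = f j\<close> are treated apart, with
  \<open>monom 1 j - monom 1 i\<close>.\<close>

lemma (in vector_space) polynomial_annihilator:
  assumes B: "finite B" "range f \<subseteq> span B"
  shows "\<exists>p::'a poly. p \<noteq> 0 \<and> (\<Sum>i\<le>degree p. coeff p i *s f i) = 0"
proof (cases "inj_on f {..card B}")
  case False
  then obtain i j where ij: "i < j" "f i = f j"
    by (metis inj_onI linorder_neqE_nat)
  define p where "p = monom (1::'a) j - monom 1 i"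
  have c: "coeff p k = (if k = j then 1 else 0) - (if k = i then 1 else 0)" for k
    by (auto simp: p_def)
  have "coeff p j = 1" using ij(1) by (simp add: c)
  then have p0: "p \<noteq> 0" by auto
  have "degree p = j"
    using ij(1) by (intro antisym le_degree degree_le) (auto simp: c)
  moreover have "(\<Sum>k\<le>j. coeff p k *s f k) = (\<Sum>k\<le>j. if k = j then f k else 0) - (\<Sum>k\<le>j. if k = i then f k else 0)"
    by (subst sum_subtractf[symmetric]) (rule sum.cong, use ij in \<open>auto simp: c\<close>)
  ultimately show ?thesis using p0 ij by auto
next
  case inj: True
  let ?S = "f ` {..card B}"
  have "\<not> independent ?S"
  proof
    assume "independent ?S"
    from independent_span_bound[OF B(1) this] B(2) have "card ?S \<le> card B" by blast
    then show False using inj by (simp add: card_image)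
  qed
  then obtain u where u: "\<exists>v\<in>?S. u v \<noteq> 0" "(\<Sum>v\<in>?S. u v *s v) = 0"
    using dependent_finite[of ?S] by auto
  define p where "p = (\<Sum>i\<le>card B. monom (u (f i)) i)"
  have c: "coeff p k = (if k \<le> card B then u (f k) else 0)" for k
    by (auto simp: p_def coeff_sum)
  have p0: "p \<noteq> 0" using u(1) by (auto simp: poly_eq_iff c)
  have dp: "degree p \<le> card B" by (rule degree_le) (simp add: c)
  have "(\<Sum>i\<le>degree p. coeff p i *s f i) = (\<Sum>i\<le>card B. coeff p i *s f i)"
    using dp by (intro sum.mono_neutral_left) (auto simp: coeff_eq_0)
  also have "\<dots> = (\<Sum>i\<le>card B. u (f i) *s f i)" by (rule sum.cong) (simp_all add: c)
  also have "\<dots> = (\<Sum>v\<in>?S. u v *s v)" using inj by (simp add: sum.reindex)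
  finally show ?thesis using p0 u(2) by auto
qed

text \<open>Take \<open>p\<close> of least degree with \<open>p(T) u = 0\<close>, split off a root
  \<open>r\<close>, and write \<open>p = (X - r) q\<close>. Then \<open>q(T) u\<close> is nonzero by
  minimality and is an eigenvector for \<open>r\<close>. Linearity of \<open>T\<close> is asked for
  on \<open>U\<close> only, since \<open>T\<close> will be an inverse that exists only
  there.\<close>

lemma eigenvector_exists:
  fixes scale :: "'f::alg_closed_field \<Rightarrow> 'w::ab_group_add \<Rightarrow> 'w"
  assumes "vector_space scale"
    and U: "Modules.module.subspace scale U" and B: "finite B" "U \<subseteq> Modules.module.span scale B"
    and T: "\<And>x. x \<in> U \<Longrightarrow> T x \<in> U" 
    and T_add: "\<And>x y. x \<in> U \<Longrightarrow> y \<in> U \<Longrightarrow> T (x + y) = T x + T y"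
    and T_scale: "\<And>c x. x \<in> U \<Longrightarrow> T (scale c x) = scale c (T x)"
    and u: "u \<in> U" "u \<noteq> 0"
  shows "\<exists>r. \<exists>v\<in>U. v \<noteq> 0 \<and> T v = scale r v"
proof -
  interpret vector_space scale by fact
  define f where "f i = (T ^^ i) u" for i
  have fU: "f i \<in> U" for i by (induction i) (simp_all add: f_def u T)
  \<comment> \<open>\<open>E p\<close> is \<open>p(T) u\<close>.\<close>
  define E where "E p = (\<Sum>i\<le>degree p. scale (coeff p i) (f i))" for p
  have E: "E p = (\<Sum>i\<le>n. scale (coeff p i) (f i))" if "degree p \<le> n" for p n
    unfolding E_def using that by (intro sum.mono_neutral_left) (auto simp: coeff_eq_0)
  have EU: "E p \<in> U" for p
    unfolding E_def by (intro subspace_sum[OF U] subspace_scale[OF U] fU)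
  have T0: "T 0 = 0" using T_scale[OF u(1), of 0] by simp
  have T_sum: "T (\<Sum>i\<in>A. scale (c i) (f i)) = (\<Sum>i\<in>A. scale (c i) (T (f i)))" if "finite A" for A c
    using that
  proof induction
    case (insert a A)
    have "T (\<Sum>i\<in>insert a A. scale (c i) (f i)) = T (scale (c a) (f a) + (\<Sum>i\<in>A. scale (c i) (f i)))"
      using insert by simp
    also have "\<dots> = T (scale (c a) (f a)) + T (\<Sum>i\<in>A. scale (c i) (f i))"
      by (intro T_add subspace_sum[OF U] subspace_scale[OF U] fU)
    finally show ?case using insert by (simp add: T_scale fU)
  qed (simp add: T0)
  \<comment> \<open>Horner's rule: multiplication of the polynomial by \<open>X\<close> becomes an
    application of \<open>T\<close>.\<close>
  have E_pCons: "E (pCons a p) = scale a u + T (E p)" for a p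
  proof -
    have "E (pCons a p) = (\<Sum>i\<le>Suc (degree p). scale (coeff (pCons a p) i) (f i))"
      by (rule E) (simp add: degree_pCons_le)
    also have "\<dots> = scale a u + (\<Sum>i\<le>degree p. scale (coeff p i) (f (Suc i)))"
      by (simp only: sum.atMost_Suc_shift) (simp add: f_def)
    also have "(\<Sum>i\<le>degree p. scale (coeff p i) (f (Suc i))) = T (E p)"
      unfolding E_def using T_sum[of "{..degree p}" "coeff p"] by (simp add: f_def)
    finally show ?thesis .
  qed
  have E_add: "E (p + q) = E p + E q" for p q
  proof -
    let ?n = "max (degree p) (degree q)"
    have "E (p + q) = (\<Sum>i\<le>?n. scale (coeff (p + q) i) (f i))"
      by (rule E) (rule degree_add_le_max)
    also have "\<dots> = E p + E q"
      by (subst (1 2) E[of _ ?n]) (simp_all add: scale_left_distrib sum.distrib)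
    finally show ?thesis .
  qed
  have E_smult: "E (smult c p) = scale c (E p)" for c p
    by (subst E[of _ "degree p"]) (simp_all add: degree_smult_le E_def scale_sum_right)
  have ex: "\<exists>p. p \<noteq> 0 \<and> E p = 0"
    unfolding E_def by (rule polynomial_annihilator[OF B(1)]) (use fU B(2) in auto)
  define p where "p = (ARG_MIN degree p. p \<noteq> 0 \<and> E p = 0)"
  have p: "p \<noteq> 0" "E p = 0"
    using arg_min_natI[of "\<lambda>p. p \<noteq> 0 \<and> E p = 0" _ degree] ex unfolding p_def by auto
  have min: "degree p \<le> degree q" if "q \<noteq> 0" "E q = 0" for q
    unfolding p_def using that by (intro arg_min_nat_le) simp
  \<comment> \<open>A nonzero constant polynomial does not annihilate \<open>u\<close>, so
    \<open>p\<close> has a root.\<close>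
  have "degree p > 0"
  proof (rule ccontr)
    assume "\<not> degree p > 0"
    then obtain c where "p = [:c:]" by (auto dest: degree_eq_zeroE)
    then show False using p u(2) by (simp add: E_def f_def)
  qed
  then obtain r where "poly p r = 0" using alg_closed_imp_poly_has_root by blast
  then obtain q where q: "p = [:-r, 1:] * q" by (metis dvdE poly_eq_0_iff_dvd)
  have "q \<noteq> 0" using q p(1) by auto
  moreover have "degree q < degree p"
    unfolding q using \<open>q \<noteq> 0\<close> by (subst degree_mult_eq) auto
  ultimately have nz: "E q \<noteq> 0" using min[of q] by fastforce
  have "[:-r, 1:] * q = smult (- r) q + pCons 0 q" by simp
  then have "E p = scale (- r) (E q) + T (E q)"
    unfolding q by (simp only: E_add E_smult E_pCons scale_zero_left add_0)
  then have "T (E q) = scale r (E q)" using p(2) by (simp add: eq_neg_iff_add_eq_0 add.commute)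
  then show ?thesis using nz EU by blast
qed

lemma linear_pencil_eigenvector:
  fixes scale :: "'f::alg_closed_field \<Rightarrow> 'w::ab_group_add \<Rightarrow> 'w"
  assumes "vector_space scale"
    and x: "Vector_Spaces.linear scale scale x" and y: "Vector_Spaces.linear scale scale y"
    and U: "Modules.module.subspace scale U" and B: "finite B" "U \<subseteq> Modules.module.span scale B"
    and xU: "x ` U \<subseteq> y ` U" and inj: "inj_on y U" and nz: "U \<noteq> {0}"
  shows "\<exists>r. \<exists>v\<in>U. v \<noteq> 0 \<and> x v = scale r (y v)"
proof -
  interpret vector_space scale by fact
  interpret P: vector_space_pair scale scale by unfold_locales
  define T where "T v = inv_into U y (x v)" for v
  have T: "T v \<in> U" and yT: "y (T v) = x v" if "v \<in> U" for v
    using inv_into_into[of "x v" y U] f_inv_into_f[of "x v" y U] that xU unfolding T_def by blast+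
  have add: "T (v + w) = T v + T w" if "v \<in> U" "w \<in> U" for v w
    by (rule inj_onD[OF inj]) (use that in \<open>simp_all add: yT T subspace_add[OF U] P.linear_add[OF x] P.linear_add[OF y]\<close>)
  have sc: "T (scale c v) = scale c (T v)" if "v \<in> U" for c v
    by (rule inj_onD[OF inj]) (use that in \<open>simp_all add: yT T subspace_scale[OF U] P.linear_scale[OF x] P.linear_scale[OF y]\<close>)
  obtain u where "u \<in> U" "u \<noteq> 0" using nz subspace_0[OF U] by blast
  from eigenvector_exists[OF \<open>vector_space scale\<close> U B T add sc this]
  obtain r v where v: "v \<in> U" "v \<noteq> 0" "T v = scale r v" by blast
  have "x v = y (T v)" using yT v(1) by simp
  also have "\<dots> = scale r (y v)" using v(3) P.linear_scale[OF y] by simp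
  finally show ?thesis using v by blast
qed

section \<open>Graded systems of commuting operators\<close>

text \<open>If degree \<open>m\<close> vanishes, all operators kill degree \<open>m + 1\<close>, and
  effectivity makes that degree vanish as well. The contrapositive is what gets used: nonzero in
  high degrees implies nonzero in every lower one.\<close>

lemma graded_zero_up:
  fixes K :: "nat \<Rightarrow> 'w::zero set"
  assumes "\<And>m x b. x \<in> K (Suc m) \<Longrightarrow> b \<in> I \<Longrightarrow> D b x \<in> K m"
    and "\<And>m x. x \<in> K (Suc m) \<Longrightarrow> (\<And>b. b \<in> I \<Longrightarrow> D b x = 0) \<Longrightarrow> x = 0"
    and "K n \<subseteq> {0}" "n \<le> m"
  shows "K m \<subseteq> {0}"
  using assms(4)
proof (induction m rule: dec_induct)
  case (step m)
  then show ?case using assms(1,2) by blast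
qed (rule assms(3))

text \<open>The model is the prolongation over the algebraic closure: \<open>W m\<close> stands for
  symmetric \<open>m\<close>-linear maps and \<open>D b\<close> for contraction with a basis vector
  \<open>b\<close>. All degrees lie in one vector space, so each operator is a single linear
  map.\<close>

locale graded_system = vector_space scale
  for scale :: "'f::alg_closed_field \<Rightarrow> 'w::ab_group_add \<Rightarrow> 'w" +
  fixes I :: "'b set" and D :: "'b \<Rightarrow> 'w \<Rightarrow> 'w" and W :: "nat \<Rightarrow> 'w set"
  assumes linear_D: "b \<in> I \<Longrightarrow> Vector_Spaces.linear scale scale (D b)"
    and subspace_W: "subspace (W m)"
    and finite_W: "\<exists>B. finite B \<and> W m \<subseteq> span B"
    and nonzero_W: "W m \<noteq> {0}"
    and D_W: "x \<in> W (Suc m) \<Longrightarrow> b \<in> I \<Longrightarrow> D b x \<in> W m"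
    and D_commute: "a \<in> I \<Longrightarrow> b \<in> I \<Longrightarrow> D a (D b x) = D b (D a x)"
    and effective: "x \<in> W (Suc m) \<Longrightarrow> (\<And>b. b \<in> I \<Longrightarrow> D b x = 0) \<Longrightarrow> x = 0"
begin

text \<open>Being nonzero in every degree is part of the notion, so that a minimal subsystem cannot
  degenerate to zero.\<close>

definition subsystem :: "(nat \<Rightarrow> 'w set) \<Rightarrow> bool"
  where "subsystem M \<longleftrightarrow> (\<forall>m. subspace (M m) \<and> M m \<subseteq> W m \<and> M m \<noteq> {0} \<and>
    (\<forall>x\<in>M (Suc m). \<forall>b\<in>I. D b x \<in> M m))"

lemma subsystemD:
  assumes "subsystem M"
  shows "subspace (M m)" "M m \<subseteq> W m" "M m \<noteq> {0}" "x \<in> M (Suc m) \<Longrightarrow> b \<in> I \<Longrightarrow> D b x \<in> M m"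
  using assms by (simp_all add: subsystem_def)

text \<open>Zorn's lemma for reversed inclusion. The lower bound of a chain is its degreewise
  intersection, and finite dimension keeps this nonzero in each degree.\<close>

lemma minimal_subsystem_exists:
  "\<exists>M. subsystem M \<and> (\<forall>M'. subsystem M' \<and> M' \<le> M \<longrightarrow> M' = M)"
proof -
  have "\<exists>M\<in>Collect subsystem. \<forall>M'\<in>Collect subsystem. M' \<le> M \<longrightarrow> M' = M"
  proof (rule predicate_Zorn)
    show "partial_order_on (Collect subsystem) (relation_of (\<lambda>M M'. M' \<le> M) (Collect subsystem))"
      by (rule partial_order_on_relation_ofI) auto
  next
    fix C assume "C \<in> Chains (relation_of (\<lambda>M M'. M' \<le> M) (Collect subsystem))"
    then have C: "C \<subseteq> Collect subsystem" and chain: "\<And>M M'. M \<in> C \<Longrightarrow> M' \<in> C \<Longrightarrow> M \<le> M' \<or> M' \<le> M"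
      by (auto simp: Chains_def relation_of_def)
    show "\<exists>M\<in>Collect subsystem. \<forall>M'\<in>C. M \<le> M'"
    proof (cases "C = {}")
      case True
      have "subsystem W"
        by (simp add: subsystem_def subspace_W nonzero_W D_W)
      then show ?thesis using True by blast
    next
      case False
      define N where "N m = (\<Inter>M\<in>C. M m)" for m
      have sub: "subsystem M" if "M \<in> C" for M using that C by blast
      have "N m \<noteq> {0}" for m
      proof -
        \<comment> \<open>For fixed \<open>m\<close>, a chain member of least dimension in degree
          \<open>m\<close> is contained in all the others in that degree, so there the intersection
          equals it.\<close>
        obtain M where M: "M \<in> C" and min: "\<And>M'. M' \<in> C \<Longrightarrow> dim (M m) \<le> dim (M' m)"
          using False ex_has_least_nat[of "\<lambda>M. M \<in> C" _ "\<lambda>M. dim (M m)"] by (metis ex_in_conv)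
        obtain B where B: "finite B" "W m \<subseteq> span B" using finite_W by blast
        have "M m \<subseteq> M' m" if "M' \<in> C" for M'
        proof (rule ccontr)
          assume n: "\<not> M m \<subseteq> M' m"
          then have "\<not> M \<le> M'" by (auto simp: le_fun_def)
          then have "M' \<le> M" using chain[OF M that] by blast
          then have "M' m \<subset> M m" using n by (auto simp: le_fun_def)
          moreover have "subspace (M' m)" "M m \<subseteq> span B"
            using subsystemD(1,2)[OF sub] that M B(2) by blast+
          ultimately have "dim (M' m) < dim (M m)" by (intro dim_less_of_psubset[OF _ _ _ B(1)])
          then show False using min[OF that] by simp
        qed
        then have "N m = M m" using M by (auto simp: N_def)
        then show ?thesis using subsystemD(3)[OF sub[OF M]] by simp
      qed
      moreover have "subspace (N m)" for m
        unfolding N_def using subsystemD(1)[OF sub] by (intro subspace_Inter) auto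
      moreover have "N m \<subseteq> W m" for m
        using False subsystemD(2)[OF sub] by (fastforce simp: N_def)
      moreover have "D b x \<in> N m" if "x \<in> N (Suc m)" "b \<in> I" for x b m
        using that subsystemD(4)[OF sub] by (auto simp: N_def)
      ultimately have "subsystem N" by (simp add: subsystem_def)
      moreover have "N \<le> M" if "M \<in> C" for M
        using that by (auto simp: N_def le_fun_def)
      ultimately show ?thesis by blast
    qed
  qed
  then show ?thesis by blast
qed

text \<open>Kernel and image of \<open>z\<close> are stable under the operators because
  \<open>z\<close> commutes with them. If the kernel is nonzero in every degree, minimality makes it
  everything. Otherwise it vanishes from some degree on; then the image is nonzero in every degree,
  and minimality makes the image everything.\<close>

lemma shift_zero_or_onto:
  assumes M: "subsystem M" and min: "\<And>M'. subsystem M' \<Longrightarrow> M' \<le> M \<Longrightarrow> M' = M"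
    and z: "Vector_Spaces.linear scale scale z"
    and zM: "\<And>m x. x \<in> M (Suc m) \<Longrightarrow> z x \<in> M m"
    and comm: "\<And>b x. b \<in> I \<Longrightarrow> D b (z x) = z (D b x)"
  shows "(\<forall>m. \<forall>x\<in>M (Suc m). z x = 0) \<or>
    (\<forall>m. z ` M (Suc m) = M m) \<and> (\<exists>n. \<forall>m\<ge>n. inj_on z (M (Suc m)))"
proof -
  interpret P: vector_space_pair scale scale by unfold_locales
  have sM: "subspace (M m)" and MW: "M m \<subseteq> W m" and nzM: "M m \<noteq> {0}"
    and DM: "x \<in> M (Suc m) \<Longrightarrow> b \<in> I \<Longrightarrow> D b x \<in> M m" for m x b
    by (rule subsystemD[OF M])+
  have effM: "x = 0" if "x \<in> M (Suc m)" "\<And>b. b \<in> I \<Longrightarrow> D b x = 0" for x m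
    using effective that MW by blast
  \<comment> \<open>In degree zero nothing is known about \<open>z\<close>, so all of
    \<open>M 0\<close> is taken. The conclusion concerns positive degrees only.\<close>
  define K where "K m = {x\<in>M m. m = 0 \<or> z x = 0}" for m
  have sK: "subspace (K m)" for m
    using sM[of m] by (auto simp: K_def subspace_def P.linear_add[OF z] P.linear_scale[OF z] P.linear_0[OF z])
  have DK: "D b x \<in> K m" if "x \<in> K (Suc m)" "b \<in> I" for x b m
  proof -
    have "z (D b x) = D b (z x)" using comm that(2) by simp
    also have "\<dots> = 0" using that P.linear_0[OF linear_D] by (simp add: K_def)
    finally show ?thesis using that DM by (simp add: K_def)
  qed
  show ?thesis
  proof (cases "\<forall>m. K m \<noteq> {0}")
    case True
    have "K \<le> M" by (auto simp: K_def le_fun_def)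
    moreover have "K m \<subseteq> W m" for m using MW by (auto simp: K_def)
    ultimately have "K = M" using True sK DK by (intro min) (auto simp: subsystem_def)
    then have "\<forall>x\<in>M (Suc m). z x = 0" for m
      by (metis (mono_tags, lifting) K_def mem_Collect_eq nat.distinct(1))
    then show ?thesis by blast
  next
    case False
    then obtain n where n: "K n = {0}" by blast
    have effK: "x = 0" if "x \<in> K (Suc m)" "\<And>b. b \<in> I \<Longrightarrow> D b x = 0" for m x
      by (rule effM) (use that in \<open>auto simp: K_def\<close>)
    have K0: "K m \<subseteq> {0}" if "n \<le> m" for m
      using graded_zero_up[of K I D n m, OF DK effK] n that by simp
    have inj: "inj_on z (M (Suc m))" if "n \<le> m" for m
    proof (rule inj_onI)
      fix x y assume xy: "x \<in> M (Suc m)" "y \<in> M (Suc m)" "z x = z y"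
      then have "x - y \<in> K (Suc m)"
        using subspace_diff[OF sM] by (simp add: K_def P.linear_diff[OF z])
      then show "x = y" using K0[of "Suc m"] that by auto
    qed
    define Z where "Z m = z ` M (Suc m)" for m
    have ZM: "Z m \<subseteq> M m" for m using zM by (auto simp: Z_def)
    have DZ: "D b x \<in> Z m" if "x \<in> Z (Suc m)" "b \<in> I" for x b m
      using that DM comm by (auto simp: Z_def)
    have sZ: "subspace (Z m)" for m
      unfolding Z_def by (intro P.linear_subspace_image[OF z] sM)
    have effZ: "x = 0" if "x \<in> Z (Suc m)" "\<And>b. b \<in> I \<Longrightarrow> D b x = 0" for m x
      by (rule effM) (use that ZM in auto)
    \<comment> \<open>If the image vanished in degree \<open>m\<close>, it would vanish in degree
      \<open>max m n\<close>, where it comes from a nonzero space on which \<open>z\<close> is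
      injective.\<close>
    have nzZ: "Z m \<noteq> {0}" for m
    proof
      assume "Z m = {0}"
      then have "Z (max m n) \<subseteq> {0}"
        using graded_zero_up[of Z I D m "max m n", OF DZ effZ] by simp
      moreover obtain x where "x \<in> M (Suc (max m n))" "x \<noteq> 0"
        using nzM[of "Suc (max m n)"] subspace_0[OF sM] by blast
      ultimately have "z x = z 0" "x \<noteq> 0" "x \<in> M (Suc (max m n))"
        by (auto simp: Z_def P.linear_0[OF z])
      then show False using inj[of "max m n"] subspace_0[OF sM] by (auto dest: inj_onD)
    qed
    have "Z = M"
      using ZM sZ nzZ DZ order_trans[OF ZM MW] by (intro min) (simp_all add: subsystem_def le_fun_def)
    then show ?thesis using inj by (auto simp: Z_def fun_eq_iff)
  qed
qed

theorem common_eigenvector: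
  "\<exists>u\<in>W 1. \<exists>w\<in>W 0. \<exists>l. w \<noteq> 0 \<and> (\<exists>b\<in>I. l b \<noteq> 0) \<and> (\<forall>b\<in>I. D b u = scale (l b) w)"
proof -
  interpret P: vector_space_pair scale scale by unfold_locales
  obtain M where M: "subsystem M" and min: "\<And>M'. subsystem M' \<Longrightarrow> M' \<le> M \<Longrightarrow> M' = M"
    using minimal_subsystem_exists by blast
  have sM: "subspace (M m)" and MW: "M m \<subseteq> W m" and nzM: "M m \<noteq> {0}"
    and DM: "x \<in> M (Suc m) \<Longrightarrow> b \<in> I \<Longrightarrow> D b x \<in> M m" for m x b
    by (rule subsystemD[OF M])+
  \<comment> \<open>Effectivity in degree one yields an operator \<open>D c\<close> that is not zero
    on \<open>M\<close>; the dichotomy then makes it onto, and injective in high degrees.\<close>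
  obtain x c where xc: "x \<in> M (Suc 0)" "c \<in> I" "D c x \<noteq> 0"
  proof -
    obtain x where "x \<in> M (Suc 0)" "x \<noteq> 0" using nzM subspace_0[OF sM] by blast
    then show ?thesis using effective[of x 0] MW that by blast
  qed
  from shift_zero_or_onto[OF M min linear_D[OF xc(2)] DM[OF _ xc(2)] D_commute[OF _ xc(2)]] xc
  obtain n where onto: "\<And>m. D c ` M (Suc m) = M m" and inj: "inj_on (D c) (M (Suc n))"
    by blast
  obtain B where B: "finite B" "W (Suc n) \<subseteq> span B" using finite_W by blast
  have MB: "M (Suc n) \<subseteq> span B" using MW B(2) by blast
  have dims: "dim (M (Suc n)) = dim (M n)"
    using dim_inj_image[OF linear_D[OF xc(2)] sM inj] onto by simp
  have "\<exists>r. \<forall>m. \<forall>x\<in>M (Suc m). D a x = scale r (D c x)" if a: "a \<in> I" for a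
  proof -
    \<comment> \<open>\<open>D c\<close> maps \<open>M (Suc n)\<close> bijectively onto
      \<open>M n\<close>, so \<open>D a\<close> can be divided by it, and the quotient has an
      eigenvalue \<open>r\<close>.\<close>
    have "D a ` M (Suc n) \<subseteq> D c ` M (Suc n)" using DM a onto by blast
    from linear_pencil_eigenvector[OF vector_space_axioms linear_D[OF a] linear_D[OF xc(2)] sM B(1) MB this inj nzM]
    obtain r v where v: "v \<in> M (Suc n)" "v \<noteq> 0" "D a v = scale r (D c v)" by blast
    define z where "z x = D a x - scale r (D c x)" for x
    have z: "Vector_Spaces.linear scale scale z"
      unfolding z_def by (intro P.linear_compose_sub linear_D a P.linear_compose_scale_right xc(2))
    \<comment> \<open>The eigenvector \<open>v\<close> lies in the kernel of \<open>z\<close>.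
      Source and target have equal dimension, so \<open>z\<close> is not onto, which rules out the
      second alternative of the dichotomy.\<close>
    have "\<not> z ` M (Suc n) = M n"
      using linear_surj_imp_inj_on[OF z sM _ MB B(1) dims v(1)] v by (auto simp: z_def)
    moreover have "z x \<in> M m" if "x \<in> M (Suc m)" for x m
      unfolding z_def by (intro subspace_diff[OF sM] subspace_scale[OF sM] DM that a xc(2))
    moreover have "D b (z x) = z (D b x)" if b: "b \<in> I" for b x
      using b xc(2) a by (simp add: z_def P.linear_diff[OF linear_D] P.linear_scale[OF linear_D] D_commute[of b])
    ultimately have "z x = 0" if "x \<in> M (Suc m)" for x m
      using shift_zero_or_onto[OF M min z] that by blast
    then show ?thesis by (auto simp: z_def)
  qed
  \<comment> \<open>The dichotomy covers all positive degrees at once, so the constant found in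
    degree \<open>Suc n\<close> serves in degree one too.\<close>
  then obtain l where l: "\<And>a m x. a \<in> I \<Longrightarrow> x \<in> M (Suc m) \<Longrightarrow> D a x = scale (l a) (D c x)"
    by metis
  obtain w where w: "w \<in> M 0" "w \<noteq> 0" using nzM subspace_0[OF sM] by blast
  obtain u where u: "u \<in> M (Suc 0)" "D c u = w"
    using w(1) onto[of 0] by (metis imageE)
  have "l c \<noteq> 0" using l[OF xc(2) u(1)] u(2) w(2) by auto
  show ?thesis
  proof (intro bexI exI conjI ballI)
    show "u \<in> W 1" using MW[of "Suc 0"] u(1) by auto
    show "w \<in> W 0" using MW w(1) by blast
    show "D b u = scale (l b) w" if "b \<in> I" for b using l[OF that u(1)] u(2) by simp
  qed (use w(2) xc(2) \<open>l c \<noteq> 0\<close> in auto)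
qed

end

section \<open>The extension of scalars in coordinates\<close>

text \<open>The module laws hold pointwise for functions and are carried to \<open>M\<close> along
  \<open>\<phi>\<close>. This lets modules whose elements are cosets be handled through coordinate
  functions.\<close>

lemma vectorspace_of_functions:
  fixes M :: "('f::field, 'm) module" and \<phi> :: "('i \<Rightarrow> 'f) \<Rightarrow> 'm"
  assumes carrier: "carrier M = \<phi> ` E" and zero: "\<zero>\<^bsub>M\<^esub> = \<phi> 0"
    and add: "\<And>u v. u \<in> E \<Longrightarrow> v \<in> E \<Longrightarrow> \<phi> u \<oplus>\<^bsub>M\<^esub> \<phi> v = \<phi> (u + v)"
    and smult: "\<And>a u. u \<in> E \<Longrightarrow> a \<odot>\<^bsub>M\<^esub> \<phi> u = \<phi> (scale_fun (*) a u)"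
    and X0: "0 \<in> E" and X_add: "\<And>u v. u \<in> E \<Longrightarrow> v \<in> E \<Longrightarrow> u + v \<in> E"
    and X_scale: "\<And>a u. u \<in> E \<Longrightarrow> scale_fun (*) a u \<in> E"
  shows "vectorspace ring_of_type_algebra M"
proof -
  interpret K: Ring.field "ring_of_type_algebra :: 'f ring" by (rule field_from_type_algebra)
  have ab: "abelian_group M"
  proof (rule abelian_groupI)
    fix x assume "x \<in> carrier M"
    then obtain u where u: "x = \<phi> u" "u \<in> E" by (auto simp: carrier)
    have "scale_fun (*) (- 1) u + u = 0" by (auto simp: scale_fun_def)
    then have "\<phi> (scale_fun (*) (- 1) u) \<oplus>\<^bsub>M\<^esub> x = \<zero>\<^bsub>M\<^esub>"
      using add[OF X_scale[OF u(2)] u(2), of "- 1"] u(1) zero by simp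
    then show "\<exists>y\<in>carrier M. y \<oplus>\<^bsub>M\<^esub> x = \<zero>\<^bsub>M\<^esub>"
      using X_scale[OF u(2)] by (auto simp: carrier)
  qed (auto simp: carrier zero add X0 X_add ac_simps)
  have "Module.module ring_of_type_algebra M"
  proof (rule Module.module.intro)
    show "abelian_group M" by (rule ab)
    have sf: "scale_fun (*) (a + b) u = scale_fun (*) a u + scale_fun (*) b u"
      "scale_fun (*) a (u + v) = scale_fun (*) a u + scale_fun (*) a v"
      "scale_fun (*) a (scale_fun (*) b u) = scale_fun (*) (a * b) u"
      "scale_fun (*) 1 u = u" for a b :: 'f and u v :: "'i \<Rightarrow> 'f"
      by (auto simp: scale_fun_def algebra_simps)
    show "module_axioms ring_of_type_algebra M"
      by (rule module_axioms.intro) (auto simp: carrier smult X_scale add X_add ring_of_type_algebra_def sf)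
  qed (rule K.cring_axioms)
  then show ?thesis by (intro vectorspace.intro K.field_axioms)
qed

text \<open>Injectivity of \<open>\<phi>\<close> carries the statement from \<open>M\<close> to
  functions, where having dimension one means being the multiples of one nonzero function. The
  family \<open>g\<close> is there to witness finite dimension.\<close>

lemma dim_functions_eq_1_iff:
  fixes M :: "('f::field, 'm) module" and \<phi> :: "('i \<Rightarrow> 'f) \<Rightarrow> 'm"
  assumes carrier: "carrier M = \<phi> ` E" and zero: "\<zero>\<^bsub>M\<^esub> = \<phi> 0"
    and add: "\<And>u v. u \<in> E \<Longrightarrow> v \<in> E \<Longrightarrow> \<phi> u \<oplus>\<^bsub>M\<^esub> \<phi> v = \<phi> (u + v)"
    and smult: "\<And>a u. u \<in> E \<Longrightarrow> a \<odot>\<^bsub>M\<^esub> \<phi> u = \<phi> (scale_fun (*) a u)"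
    and X0: "0 \<in> E" and X_add: "\<And>u v. u \<in> E \<Longrightarrow> v \<in> E \<Longrightarrow> u + v \<in> E"
    and X_scale: "\<And>a u. u \<in> E \<Longrightarrow> scale_fun (*) a u \<in> E"
    and inj: "inj_on \<phi> E"
    and J: "finite J" "\<And>j. j \<in> J \<Longrightarrow> g j \<in> E"
      "\<And>u. u \<in> E \<Longrightarrow> \<exists>a. u = (\<Sum>j\<in>J. scale_fun (*) (a j) (g j))"
  shows "vectorspace.dim ring_of_type_algebra M = 1 \<longleftrightarrow>
    (\<exists>w\<in>E. w \<noteq> 0 \<and> (\<forall>u\<in>E. \<exists>a. u = scale_fun (*) a w))"
proof -
  interpret V: vectorspace "ring_of_type_algebra :: 'f ring" M
    by (rule vectorspace_of_functions[of M \<phi> E]) (fact assms)+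
  have cK: "carrier (ring_of_type_algebra :: 'f ring) = UNIV" by (simp add: ring_of_type_algebra_def)
  have span1: "V.span {\<phi> w} = {\<phi> (scale_fun (*) a w) | a. True}" if "w \<in> E" for w
  proof -
    have w: "\<phi> w \<in> carrier M" using that by (simp add: carrier)
    have "V.lincomb a {\<phi> w} = \<phi> (scale_fun (*) (a (\<phi> w)) w)" for a
      using w by (simp add: V.lincomb_def cK smult[OF that, symmetric])
    then show ?thesis using V.finite_span[of "{\<phi> w}"] w by (auto simp: cK)
  qed
  show ?thesis
  proof
    assume dim: "V.dim = 1"
    have sub: "\<phi> ` g ` J \<subseteq> carrier M" using J(2) by (auto simp: carrier)
    have "V.span (\<phi> ` g ` J) = carrier M"
    proof (rule antisym)
      show "V.span (\<phi> ` g ` J) \<subseteq> carrier M" using sub by (rule V.span_is_subset2)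
      show "carrier M \<subseteq> V.span (\<phi> ` g ` J)"
      proof
        fix x assume "x \<in> carrier M"
        then obtain u where u: "u \<in> E" "x = \<phi> u" by (auto simp: carrier)
        obtain a where a: "u = (\<Sum>j\<in>J. scale_fun (*) (a j) (g j))" using J(3)[OF u(1)] by blast
        have "LinearCombinations.submodule ring_of_type_algebra (V.span (\<phi> ` g ` J)) M"
          by (rule V.span_is_submodule[OF sub])
        then have S: "\<zero>\<^bsub>M\<^esub> \<in> V.span (\<phi> ` g ` J)"
          "\<And>v w. v \<in> V.span (\<phi> ` g ` J) \<Longrightarrow> w \<in> V.span (\<phi> ` g ` J) \<Longrightarrow> v \<oplus>\<^bsub>M\<^esub> w \<in> V.span (\<phi> ` g ` J)"
          "\<And>c v. v \<in> V.span (\<phi> ` g ` J) \<Longrightarrow> c \<odot>\<^bsub>M\<^esub> v \<in> V.span (\<phi> ` g ` J)"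
          by (auto simp: submodule_def cK)
        have "(\<Sum>j\<in>F. scale_fun (*) (a j) (g j)) \<in> E \<and>
            \<phi> (\<Sum>j\<in>F. scale_fun (*) (a j) (g j)) \<in> V.span (\<phi> ` g ` J)" if "finite F" "F \<subseteq> J" for F
          using that
        proof induction
          case empty
          show ?case using X0 S(1) zero by (simp add: zero_fun_def)
        next
          case (insert j F)
          have j: "scale_fun (*) (a j) (g j) \<in> E" using insert J(2) X_scale by blast
          have "\<phi> (g j) \<in> V.span (\<phi> ` g ` J)"
            using V.in_own_span[OF sub] insert by blast
          then have sc: "\<phi> (scale_fun (*) (a j) (g j)) \<in> V.span (\<phi> ` g ` J)"
            using S(3)[of "\<phi> (g j)" "a j"] smult[of "g j" "a j"] insert.prems J(2) cK by auto
          have eq: "(\<Sum>j\<in>insert j F. scale_fun (*) (a j) (g j)) =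
              scale_fun (*) (a j) (g j) + (\<Sum>j\<in>F. scale_fun (*) (a j) (g j))"
            using insert by (intro sum.insert)
          have IH: "(\<Sum>j\<in>F. scale_fun (*) (a j) (g j)) \<in> E"
            "\<phi> (\<Sum>j\<in>F. scale_fun (*) (a j) (g j)) \<in> V.span (\<phi> ` g ` J)"
            using insert by auto
          show ?case
            unfolding eq by (rule conjI[OF X_add[OF j IH(1)] S(2)[OF sc IH(2), unfolded add[OF j IH(1)]]])
        qed
        from this[OF J(1) order_refl] show "x \<in> V.span (\<phi> ` g ` J)" using u(2) a by simp
      qed
    qed
    \<comment> \<open>The dimension is a least cardinality of a finite spanning set. Only after one
      such set is exhibited does \<open>dim = 1\<close> yield a single spanning vector.\<close>
    then have "\<exists>n A. finite A \<and> card A = n \<and> A \<subseteq> carrier M \<and> V.span A = carrier M"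
      by (intro exI[of _ "card (\<phi> ` g ` J)"] exI[of _ "\<phi> ` g ` J"]) (simp add: J(1) sub)
    then have "\<exists>A. finite A \<and> card A = V.dim \<and> A \<subseteq> carrier M \<and> V.span A = carrier M"
      unfolding V.dim_def by (rule LeastI_ex)
    then obtain x where x: "x \<in> carrier M" "V.span {x} = carrier M"
      using dim by (auto simp: card_Suc_eq)
    then obtain w where w: "w \<in> E" "x = \<phi> w" by (auto simp: carrier)
    have "w \<noteq> 0"
    proof
      assume "w = 0"
      then have "V.span {\<zero>\<^bsub>M\<^esub>} = carrier M" using w x zero by simp
      then show False using V.dim0I dim by simp
    qed
    moreover have "\<exists>a. u = scale_fun (*) a w" if "u \<in> E" for u
    proof -
      have "\<phi> u \<in> V.span {\<phi> w}" using that x(2) w(2) by (simp add: carrier)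
      then obtain a where "\<phi> u = \<phi> (scale_fun (*) a w)" using span1[OF w(1)] by blast
      then have "u = scale_fun (*) a w" using inj_onD[OF inj] that X_scale[OF w(1)] by blast
      then show ?thesis by blast
    qed
    ultimately show "\<exists>w\<in>E. w \<noteq> 0 \<and> (\<forall>u\<in>E. \<exists>a. u = scale_fun (*) a w)" using w(1) by blast
  next
    assume "\<exists>w\<in>E. w \<noteq> 0 \<and> (\<forall>u\<in>E. \<exists>a. u = scale_fun (*) a w)"
    then obtain w where w: "w \<in> E" "w \<noteq> 0" "\<And>u. u \<in> E \<Longrightarrow> \<exists>a. u = scale_fun (*) a w" by blast
    show "V.dim = 1"
    proof (rule V.dim1I)
      show "V.span {\<phi> w} = carrier M"
        unfolding span1[OF w(1)] carrier using w(3) X_scale[OF w(1)] by blast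
      show "\<phi> w \<noteq> \<zero>\<^bsub>M\<^esub>" using inj_onD[OF inj _ w(1) X0] w(2) by (auto simp: zero)
      show "\<phi> w \<in> carrier M" using w(1) by (simp add: carrier)
    qed
  qed
qed

section \<open>Homomorphisms from a free abelian group to a commutative ring\<close>

definition frag_eval :: "('a \<Rightarrow> 'f::comm_ring_1) \<Rightarrow> ('a \<Rightarrow>\<^sub>0 int) \<Rightarrow> 'f"
  where "frag_eval h x = (\<Sum>a\<in>Poly_Mapping.keys x. of_int (poly_mapping.lookup x a) * h a)"

lemma frag_eval_superset:
  "finite S \<Longrightarrow> Poly_Mapping.keys x \<subseteq> S \<Longrightarrow>
    frag_eval h x = (\<Sum>a\<in>S. of_int (poly_mapping.lookup x a) * h a)"
  unfolding frag_eval_def by (rule sum.mono_neutral_left) (auto simp: in_keys_iff)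

lemma frag_eval_0 [simp]: "frag_eval h 0 = 0"
  by (simp add: frag_eval_def)

lemma frag_eval_of [simp]: "frag_eval h (frag_of a) = h a"
  by (simp add: frag_eval_def)

lemma frag_eval_diff [simp]: "frag_eval h (x - y) = frag_eval h x - frag_eval h y"
proof -
  let ?S = "Poly_Mapping.keys x \<union> Poly_Mapping.keys y"
  have "frag_eval h (x - y) = (\<Sum>a\<in>?S. of_int (poly_mapping.lookup (x - y) a) * h a)"
    by (rule frag_eval_superset) (use keys_diff[of x y] in auto)
  also have "\<dots> = frag_eval h x - frag_eval h y"
    by (subst (1 2) frag_eval_superset[of ?S])
      (auto simp: lookup_minus left_diff_distrib sum_subtractf)
  finally show ?thesis .
qed

lemma frag_eval_minus [simp]: "frag_eval h (- x) = - frag_eval h x"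
  using frag_eval_diff[of h 0 x] by simp

lemma frag_eval_add [simp]: "frag_eval h (x + y) = frag_eval h x + frag_eval h y"
  using frag_eval_diff[of h x "- y"] by simp

lemma frag_eval_sum: "frag_eval h (\<Sum>a\<in>A. g a) = (\<Sum>a\<in>A. frag_eval h (g a))"
  by (induction A rule: infinite_finite_induct) simp_all

lemma frag_eval_cong:
  "(\<And>a. a \<in> Poly_Mapping.keys x \<Longrightarrow> h a = h' a) \<Longrightarrow> frag_eval h x = frag_eval h' x"
  unfolding frag_eval_def by (rule sum.cong) simp_all

lemma frag_eval_extend: "frag_eval h (frag_extend k x) = frag_eval (\<lambda>a. frag_eval h (k a)) x"
  by (rule frag_induction[of x UNIV]) (auto simp: frag_extend_diff)

lemma frag_eval_mult_left: "frag_eval (\<lambda>a. c * h a) x = c * frag_eval h x"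
  by (simp add: frag_eval_def sum_distrib_left mult.left_commute)

lemma frag_eval_mult_right: "frag_eval (\<lambda>a. h a * c) x = frag_eval h x * c"
  by (simp add: frag_eval_def sum_distrib_right mult.assoc)

lemma frag_eval_sum_fun: "frag_eval (\<lambda>a. \<Sum>b\<in>B. h b a) x = (\<Sum>b\<in>B. frag_eval (h b) x)"
  unfolding frag_eval_def by (subst sum.swap) (simp add: sum_distrib_left)

text \<open>This is used twice: with \<open>W\<close> the whole of \<open>V\<close>, and with
  \<open>W\<close> a space of endomorphisms inside the space of all functions.\<close>

locale ac_tensor = vector_space s for s :: "'k::field \<Rightarrow> 'b::ab_group_add \<Rightarrow> 'b" +
  fixes W :: "'b set"
  assumes subspace_W: "subspace W"
begin

abbreviation null :: "('k alg_closure \<times> 'b \<Rightarrow>\<^sub>0 int) set"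
  where "null \<equiv> tensor_null ac_scale UNIV s W"

lemma tensor_relations_keys:
  assumes "x \<in> tensor_relations ac_scale UNIV s W"
  shows "Poly_Mapping.keys x \<subseteq> UNIV \<times> W"
proof -
  have *: "Poly_Mapping.keys (a - b) \<subseteq> S" if "Poly_Mapping.keys a \<subseteq> S" "Poly_Mapping.keys b \<subseteq> S"
    for a b :: "'k alg_closure \<times> 'b \<Rightarrow>\<^sub>0 int" and S
    using keys_diff[of a b] that by blast
  show ?thesis
    using assms unfolding tensor_relations_def
    by (elim UnE CollectE exE conjE)
      (simp_all add: * subspace_add[OF subspace_W] subspace_scale[OF subspace_W])
qed

lemma null_subgroup: "subgroup null (free_Abelian_group (UNIV \<times> W))"
  unfolding tensor_null_def
  by (rule group.generate_is_subgroup) (auto dest!: tensor_relations_keys)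

lemma null_keys: "x \<in> null \<Longrightarrow> Poly_Mapping.keys x \<subseteq> UNIV \<times> W"
  using subgroup.mem_carrier[OF null_subgroup] by simp

lemma null_0: "0 \<in> null"
  using subgroup.one_closed[OF null_subgroup] by simp

lemma null_add: "x \<in> null \<Longrightarrow> y \<in> null \<Longrightarrow> x + y \<in> null"
  using subgroup.m_closed[OF null_subgroup] by simp

lemma null_minus: "x \<in> null \<Longrightarrow> - x \<in> null"
  using subgroup.m_inv_closed[OF null_subgroup, of x] null_keys[of x] by simp

lemma null_diff: "x \<in> null \<Longrightarrow> y \<in> null \<Longrightarrow> x - y \<in> null"
  using null_add[OF _ null_minus] by fastforce

lemma null_sum: "(\<And>i. i \<in> I \<Longrightarrow> x i \<in> null) \<Longrightarrow> sum x I \<in> null"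
  by (induction I rule: infinite_finite_induct) (auto simp: null_0 null_add)

lemma null_relations:
  assumes "w \<in> W"
  shows "frag_of (f + f', w) - frag_of (f, w) - frag_of (f', w) \<in> null"
    and "w' \<in> W \<Longrightarrow> frag_of (f, w + w') - frag_of (f, w) - frag_of (f, w') \<in> null"
    and "frag_of (to_ac c * f, w) - frag_of (f, s c w) \<in> null"
proof -
  show "frag_of (f + f', w) - frag_of (f, w) - frag_of (f', w) \<in> null"
    unfolding tensor_null_def tensor_relations_def using assms by (intro generate.incl) blast
  show "frag_of (f, w + w') - frag_of (f, w) - frag_of (f, w') \<in> null" if "w' \<in> W"
    unfolding tensor_null_def tensor_relations_def using assms that by (intro generate.incl) blast
  have "frag_of (ac_scale c f, w) - frag_of (f, s c w) \<in> null"
    unfolding tensor_null_def tensor_relations_def using assms by (intro generate.incl) blast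
  then show "frag_of (to_ac c * f, w) - frag_of (f, s c w) \<in> null"
    by (simp add: ac_scale_def)
qed

text \<open>The universal property of the tensor product: a balanced \<open>h\<close> kills the
  defining relations, hence the subgroup that they generate.\<close>

lemma frag_eval_null:
  fixes h :: "'k alg_closure \<times> 'b \<Rightarrow> 'f::comm_ring_1"
  assumes x: "x \<in> null"
    and "\<And>f f' w. w \<in> W \<Longrightarrow> h (f + f', w) = h (f, w) + h (f', w)"
    and "\<And>f w w'. w \<in> W \<Longrightarrow> w' \<in> W \<Longrightarrow> h (f, w + w') = h (f, w) + h (f, w')"
    and "\<And>c f w. w \<in> W \<Longrightarrow> h (to_ac c * f, w) = h (f, s c w)"
  shows "frag_eval h x = 0"
proof -
  have rel: "frag_eval h r = 0" if "r \<in> tensor_relations ac_scale UNIV s W" for r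
    using that assms(2-) by (auto simp: tensor_relations_def ac_scale_def)
  show ?thesis
    using x unfolding tensor_null_def
  proof induction
    case (inv r)
    then show ?case using rel tensor_relations_keys[of r] by simp
  qed (auto simp: rel)
qed

lemma ac_class_iff: "y \<in> ac_class s W x \<longleftrightarrow> y - x \<in> null"
proof -
  have "ac_class s W x = (\<lambda>n. n + x) ` null"
    by (auto simp: ac_class_def r_coset_def)
  then show ?thesis by force
qed

lemma carrier_ac_extension:
  "carrier (ac_extension s W) = ac_class s W ` {x. Poly_Mapping.keys x \<subseteq> UNIV \<times> W}"
  by (auto simp: ac_extension_def tensor_product_def FactGroup_def RCOSETS_def ac_class_def)

lemma frag_of_zero_null: "w \<in> W \<Longrightarrow> frag_of (0, w) \<in> null"
  using null_minus[OF null_relations(1)[of w 0 0]] by simp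

lemma frag_of_right_zero_null: "frag_of (f, 0) \<in> null"
  using null_minus[OF null_relations(2)[of 0 0 f]] subspace_0[OF subspace_W] by simp

lemma frag_of_diff_null:
  assumes "w \<in> W"
  shows "frag_of (f - f', w) - frag_of (f, w) + frag_of (f', w) \<in> null"
  using null_minus[OF null_relations(1)[OF assms, of "f - f'" f']] by (simp add: algebra_simps)

end

lemma vector_space_scale_fun: "vector_space s \<Longrightarrow> vector_space (scale_fun s)"
  unfolding vector_space_def scale_fun_def by (auto simp: fun_eq_iff)

section \<open>Coordinates on the extended vector space\<close>

locale ac_coordinates = finite_dimensional_vector_space s B
  for s :: "'k::field \<Rightarrow> 'v::ab_group_add \<Rightarrow> 'v" and B :: "'v set"
begin

sublocale T: ac_tensor s UNIV
  by unfold_locales (rule subspace_UNIV)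

definition crd :: "'v \<Rightarrow> 'v \<Rightarrow> 'k alg_closure"
  where "crd v c = to_ac (representation B v c)"

definition coord :: "('k alg_closure \<times> 'v \<Rightarrow>\<^sub>0 int) \<Rightarrow> 'v \<Rightarrow> 'k alg_closure"
  where "coord x c = frag_eval (\<lambda>(f, v). f * crd v c) x"

definition coords :: "('v \<Rightarrow> 'k alg_closure) set"
  where "coords = {u. \<forall>c. c \<notin> B \<longrightarrow> u c = 0}"

definition lift :: "('v \<Rightarrow> 'k alg_closure) \<Rightarrow> ('k alg_closure \<times> 'v \<Rightarrow>\<^sub>0 int)"
  where "lift u = (\<Sum>b\<in>B. frag_of (u b, b))"

text \<open>The cosets that form the tensor product turn out to be exactly the fibres of
  \<open>coord\<close> over \<open>coords\<close>.\<close>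

definition fibre :: "('v \<Rightarrow> 'k alg_closure) \<Rightarrow> ('k alg_closure \<times> 'v \<Rightarrow>\<^sub>0 int) set"
  where "fibre u = {x. coord x = u}"

lemma crd_add [simp]: "crd (v + w) c = crd v c + crd w c"
  by (simp add: crd_def representation_add independent_Basis span_Basis)

lemma crd_scale [simp]: "crd (s k v) c = to_ac k * crd v c"
  by (simp add: crd_def representation_scale independent_Basis span_Basis)

lemma crd_zero [simp]: "crd 0 c = 0"
  using crd_scale[of 0 0] by simp

lemma crd_outside: "c \<notin> B \<Longrightarrow> crd v c = 0"
  using representation_ne_zero[of B v c] by (auto simp: crd_def)

lemma crd_basis: "b \<in> B \<Longrightarrow> crd b c = (if b = c then 1 else 0)"
  by (simp add: crd_def representation_basis independent_Basis)

lemma sum_representation: "(\<Sum>b\<in>B. s (representation B v b) b) = v"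
  by (rule sum_representation_eq) (auto simp: independent_Basis span_Basis finite_Basis)

lemma eq_of_crd:
  assumes "\<And>c. crd v c = crd w c"
  shows "v = w"
proof -
  have "representation B v b = representation B w b" for b
    using assms[of b] by (simp add: crd_def)
  then have "(\<Sum>b\<in>B. s (representation B v b) b) = (\<Sum>b\<in>B. s (representation B w b) b)"
    by (intro sum.cong) simp_all
  then show ?thesis unfolding sum_representation .
qed

lemma crd_sum: "crd (\<Sum>a\<in>A. g a) c = (\<Sum>a\<in>A. crd (g a) c)"
  by (induction A rule: infinite_finite_induct) simp_all

lemma crd_linear:
  assumes A: "Vector_Spaces.linear s s A"
  shows "crd (A v) c = (\<Sum>b\<in>B. crd v b * crd (A b) c)"
proof -
  interpret P: vector_space_pair s s by unfold_locales
  have "A v = A (\<Sum>b\<in>B. s (representation B v b) b)" by (simp add: sum_representation)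
  also have "\<dots> = (\<Sum>b\<in>B. s (representation B v b) (A b))"
    by (subst P.linear_sum[OF A]) (simp add: P.linear_scale[OF A])
  finally show ?thesis by (simp add: crd_sum) (simp add: crd_def)
qed

lemma coord_simps [simp]:
  "coord 0 = 0" "coord (x + y) = coord x + coord y" "coord (x - y) = coord x - coord y"
  "coord (- x) = - coord x"
  by (auto simp: coord_def fun_eq_iff)

lemma coord_frag_of: "coord (frag_of (f, v)) c = f * crd v c"
  by (simp add: coord_def)

lemma coord_in_coords: "coord x \<in> coords"
  by (auto simp: coords_def coord_def crd_outside frag_eval_def intro!: sum.neutral)

lemma coord_lift: "u \<in> coords \<Longrightarrow> coord (lift u) = u"
proof
  fix c assume u: "u \<in> coords"
  have "coord (lift u) c = (\<Sum>b\<in>B. u b * crd b c)"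
    by (simp add: coord_def lift_def frag_eval_sum)
  also have "\<dots> = (\<Sum>b\<in>B. if b = c then u b else 0)"
    by (rule sum.cong) (auto simp: crd_basis)
  also have "\<dots> = u c" using u finite_Basis by (auto simp: coords_def)
  finally show "coord (lift u) c = u c" .
qed

lemma coord_null: "x \<in> T.null \<Longrightarrow> coord x = 0"
  unfolding coord_def fun_eq_iff
  by (auto intro!: T.frag_eval_null simp: algebra_simps)

text \<open>The scalars are moved across the tensor sign one basis vector at a time.\<close>

lemma frag_of_scale_sum:
  "frag_of (f, \<Sum>b\<in>F. s (k b) b) - (\<Sum>b\<in>F. frag_of (f * to_ac (k b), b)) \<in> T.null"
proof (induction F rule: infinite_finite_induct)
  case (insert b F)
  let ?v = "\<Sum>b\<in>F. s (k b) b" and ?S = "\<Sum>b\<in>F. frag_of (f * to_ac (k b), b)"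
  have "(frag_of (f, s (k b) b + ?v) - frag_of (f, s (k b) b) - frag_of (f, ?v))
      - (frag_of (to_ac (k b) * f, b) - frag_of (f, s (k b) b)) + (frag_of (f, ?v) - ?S) \<in> T.null"
    by (intro T.null_add T.null_diff T.null_relations insert.IH UNIV_I)
  then show ?case using insert.hyps by (simp add: algebra_simps)
qed (simp_all add: T.frag_of_right_zero_null)

text \<open>Modulo the relations, every formal sum equals its normal form, a sum of pairs
  \<open>(u b, b)\<close> over the basis. Hence the relations generate the whole kernel of
  \<open>coord\<close>, which is the injectivity half of the coordinate description.\<close>

lemma minus_lift_null: "x - lift (coord x) \<in> T.null"
proof (rule frag_induction[of x UNIV])
  have "- (\<Sum>b\<in>B. frag_of (0, b)) \<in> T.null"
    by (intro T.null_minus T.null_sum T.frag_of_zero_null UNIV_I)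
  then show "0 - lift (coord 0) \<in> T.null" by (simp add: lift_def)
next
  fix p :: "'k alg_closure \<times> 'v"
  obtain f v where p: "p = (f, v)" by fastforce
  have "frag_of (f, v) - (\<Sum>b\<in>B. frag_of (f * crd v b, b)) \<in> T.null"
    using frag_of_scale_sum[of f "representation B v" B] by (simp add: sum_representation crd_def)
  then show "frag_of p - lift (coord (frag_of p)) \<in> T.null"
    by (simp add: p lift_def coord_frag_of)
next
  fix x y assume xy: "x - lift (coord x) \<in> T.null" "y - lift (coord y) \<in> T.null"
  \<comment> \<open>\<open>lift\<close> is additive only modulo the relations; the sum over
    \<open>B\<close> is the correction.\<close>
  have "(x - lift (coord x)) - (y - lift (coord y)) -
      (\<Sum>b\<in>B. frag_of (coord x b - coord y b, b) - frag_of (coord x b, b) + frag_of (coord y b, b)) \<in> T.null"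
    by (intro T.null_diff T.null_sum T.frag_of_diff_null xy UNIV_I)
  then show "x - y - lift (coord (x - y)) \<in> T.null"
    by (simp add: lift_def sum.distrib sum_subtractf algebra_simps)
qed simp

lemma null_iff: "x \<in> T.null \<longleftrightarrow> coord x = 0"
proof
  assume "coord x = 0"
  moreover have "lift 0 \<in> T.null"
    unfolding lift_def by (rule T.null_sum) (simp add: T.frag_of_zero_null)
  ultimately show "x \<in> T.null"
    using T.null_add[OF minus_lift_null[of x], of "lift 0"] by simp
qed (rule coord_null)

lemma ac_class_eq_fibre: "ac_class s UNIV x = fibre (coord x)"
  by (auto simp: T.ac_class_iff null_iff fibre_def)

lemma lift_fibre: "u \<in> coords \<Longrightarrow> lift u \<in> fibre u"
  by (simp add: fibre_def coord_lift)

lemma inj_fibre: "inj_on fibre coords"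
proof (rule inj_onI)
  fix u v assume u: "u \<in> coords" and "fibre u = fibre v"
  then have "lift u \<in> fibre v" using lift_fibre[OF u] by simp
  then show "u = v" using u by (simp add: fibre_def coord_lift)
qed

lemma range_coord: "range coord = coords"
  using coord_in_coords coord_lift by (auto intro: rev_image_eqI[OF UNIV_I] sym)

lemma carrier_V: "carrier (ac_extension s UNIV) = fibre ` coords"
  unfolding range_coord[symmetric] by (auto simp: T.carrier_ac_extension ac_class_eq_fibre)

lemma zero_V: "\<zero>\<^bsub>ac_extension s UNIV\<^esub> = fibre 0"
  by (auto simp: ac_extension_def tensor_product_def FactGroup_def fibre_def null_iff)

lemma add_V:
  assumes "u \<in> coords"
  shows "fibre u \<oplus>\<^bsub>ac_extension s UNIV\<^esub> fibre v = fibre (u + v)"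
proof -
  \<comment> \<open>The sum of two cosets is the set of all sums, so every formal sum with
    coordinates \<open>u + v\<close> must be split into summands from the two fibres.\<close>
  have "\<exists>y z. coord y = u \<and> coord z = v \<and> x = y + z" if "coord x = u + v" for x
    using that by (intro exI[of _ "lift u"] exI[of _ "x - lift u"]) (simp add: coord_lift assms)
  then show ?thesis
    by (auto simp: ac_extension_def tensor_product_def FactGroup_def set_mult_def fibre_def)
qed

lemma smult_V:
  assumes "u \<in> coords"
  shows "a \<odot>\<^bsub>ac_extension s UNIV\<^esub> fibre u = fibre (scale_fun (*) a u)"
proof -
  have "coord (frag_extend (\<lambda>(f, w). frag_of (a * f, w)) x) = scale_fun (*) a (coord x)" for x
  proof
    fix c
    have "coord (frag_extend (\<lambda>(f, w). frag_of (a * f, w)) x) c =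
        frag_eval (\<lambda>p. a * (case p of (f, v) \<Rightarrow> f * crd v c)) x"
      unfolding coord_def frag_eval_extend by (rule frag_eval_cong) (auto simp: mult.assoc)
    then show "coord (frag_extend (\<lambda>(f, w). frag_of (a * f, w)) x) c = scale_fun (*) a (coord x) c"
      by (simp add: frag_eval_mult_left coord_def scale_fun_def)
  qed
  then have "a \<odot>\<^bsub>ac_extension s UNIV\<^esub> fibre u = (\<Union>x\<in>fibre u. fibre (scale_fun (*) a u))"
    by (simp add: ac_extension_def ac_class_eq_fibre fibre_def)
  \<comment> \<open>The index set of the union is nonempty, so a union of equal sets is that
    set.\<close>
  moreover have "lift u \<in> fibre u" by (simp add: fibre_def coord_lift assms)
  ultimately show ?thesis by auto
qed

end

lemma sum_apply: "(\<Sum>a\<in>A. f a) x = (\<Sum>a\<in>A. f a x)" for f :: "'a \<Rightarrow> 'b \<Rightarrow> 'c::comm_monoid_add"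
  by (induction A rule: infinite_finite_induct) simp_all

text \<open>The matrix of the endomorphism of \<open>\<bbbF> \<otimes> V\<close> that a formal sum of pairs \<open>(f, A)\<close> represents;
  its rows are the images of the basis vectors.\<close>

definition (in ac_coordinates) mat ::
    "('k alg_closure \<times> ('v \<Rightarrow> 'v) \<Rightarrow>\<^sub>0 int) \<Rightarrow> 'v \<Rightarrow> 'v \<Rightarrow> 'k alg_closure"
  where "mat x b c = (if b \<in> B then frag_eval (\<lambda>(f, A). f * crd (A b) c) x else 0)"

definition (in ac_coordinates) mat_apply ::
    "('v \<Rightarrow> 'v \<Rightarrow> 'k alg_closure) \<Rightarrow> ('v \<Rightarrow> 'k alg_closure) \<Rightarrow> 'v \<Rightarrow> 'k alg_closure"
  where "mat_apply M u c = (\<Sum>b\<in>B. u b * M b c)"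

section \<open>The action of the extended Lie algebra by matrices, and its rank\<close>

locale gl_subspace = ac_coordinates s B
  for s :: "'k::field \<Rightarrow> 'v::ab_group_add \<Rightarrow> 'v" and B :: "'v set" +
  fixes L :: "('v \<Rightarrow> 'v) set"
  assumes L_gl: "L \<subseteq> gl s" and L_subspace: "Modules.module.subspace (scale_fun s) L"
begin

sublocale E: ac_tensor "scale_fun s" L
  using vector_space_scale_fun[OF vector_space_axioms] L_subspace
  by (simp add: ac_tensor_def ac_tensor_axioms_def)

lemma L_linear: "A \<in> L \<Longrightarrow> Vector_Spaces.linear s s A"
  using L_gl by (auto simp: gl_def)

lemma mat_null:
  assumes "x \<in> E.null"
  shows "mat x = 0"
proof -
  have "frag_eval (\<lambda>(f, A). f * crd (A b) c) x = 0" for b c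
    by (rule E.frag_eval_null[OF assms]) (simp_all add: scale_fun_def algebra_simps)
  then show ?thesis by (auto simp: mat_def fun_eq_iff)
qed

lemma mat_diff: "mat (x - y) = mat x - mat y"
  by (auto simp: mat_def fun_eq_iff)

lemma mat_outside: "c \<notin> B \<Longrightarrow> mat x b c = 0"
  by (auto simp: mat_def crd_outside frag_eval_def intro!: sum.neutral)

text \<open>On pairs of generators this is the expansion of \<open>A v\<close> in the basis. It
  rests on linearity of \<open>A\<close>, which is why the keys of \<open>x\<close> are confined to
  \<open>L\<close>.\<close>

lemma coord_action:
  assumes "Poly_Mapping.keys x \<subseteq> UNIV \<times> L"
  shows "coord (frag_extend (\<lambda>(f, A). frag_extend (\<lambda>(g, v). frag_of (f * g, A v)) y) x) =
    mat_apply (mat x) (coord y)"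
proof
  fix c
  have "coord (frag_extend (\<lambda>(f, A). frag_extend (\<lambda>(g, v). frag_of (f * g, A v)) y) x) c =
      frag_eval (\<lambda>p. \<Sum>b\<in>B. coord y b * (case p of (f, A) \<Rightarrow> f * crd (A b) c)) x"
    unfolding coord_def frag_eval_extend
  proof (rule frag_eval_cong)
    fix p assume "p \<in> Poly_Mapping.keys x"
    then obtain f A where p: "p = (f, A)" "A \<in> L" using assms by fastforce
    have "frag_eval (\<lambda>(g, v). f * g * crd (A v) c) y =
        frag_eval (\<lambda>q. \<Sum>b\<in>B. (case q of (g, v) \<Rightarrow> g * crd v b) * (f * crd (A b) c)) y"
    proof (rule frag_eval_cong)
      fix q :: "'k alg_closure \<times> 'v"
      obtain g v where q: "q = (g, v)" by fastforce
      show "(case q of (g, v) \<Rightarrow> f * g * crd (A v) c) =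
          (\<Sum>b\<in>B. (case q of (g, v) \<Rightarrow> g * crd v b) * (f * crd (A b) c))"
        using crd_linear[OF L_linear[OF p(2)], of v c] by (simp add: q sum_distrib_left ac_simps)
    qed
    then show "frag_eval (\<lambda>(f, v). f * crd v c)
        (case p of (f, A) \<Rightarrow> frag_extend (\<lambda>(g, v). frag_of (f * g, A v)) y) =
      (\<Sum>b\<in>B. frag_eval (\<lambda>(f, v). f * crd v b) y * (case p of (f, A) \<Rightarrow> f * crd (A b) c))"
      by (simp add: p frag_eval_extend frag_eval_sum_fun frag_eval_mult_right case_prod_unfold)
  qed
  also have "\<dots> = mat_apply (mat x) (coord y) c"
    by (simp add: frag_eval_sum_fun frag_eval_mult_left mat_apply_def mat_def)
  finally show "coord (frag_extend (\<lambda>(f, A). frag_extend (\<lambda>(g, v). frag_of (f * g, A v)) y) x) c =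
    mat_apply (mat x) (coord y) c" .
qed

text \<open>The union in \<open>ac_action\<close> runs over all representatives. Each of them has
  keys in \<open>L\<close> and the same matrix as \<open>x\<close>, so all the cosets in the union
  coincide.\<close>

lemma ac_action_fibre:
  assumes x: "Poly_Mapping.keys x \<subseteq> UNIV \<times> L" and u: "u \<in> coords"
  shows "ac_action s (ac_class (scale_fun s) L x) (fibre u) = fibre (mat_apply (mat x) u)"
proof -
  have "coord (frag_extend (\<lambda>(f, A). frag_extend (\<lambda>(g, v). frag_of (f * g, A v)) y) z) =
      mat_apply (mat x) u"
    if z: "z \<in> ac_class (scale_fun s) L x" and y: "y \<in> fibre u" for z y
  proof -
    have zx: "z - x \<in> E.null" using z by (simp add: E.ac_class_iff)
    have "Poly_Mapping.keys ((z - x) + x) \<subseteq> UNIV \<times> L"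
      using Poly_Mapping.keys_add[of "z - x" x] E.null_keys[OF zx] x by blast
    moreover have "mat z = mat x" using mat_null[OF zx] by (simp add: mat_diff)
    ultimately show ?thesis using coord_action[of z y] y by (simp add: fibre_def)
  qed
  then have "ac_action s (ac_class (scale_fun s) L x) (fibre u) =
      (\<Union>z\<in>ac_class (scale_fun s) L x. \<Union>y\<in>fibre u. fibre (mat_apply (mat x) u))"
    by (simp add: ac_action_def ac_class_eq_fibre)
  moreover have "x \<in> ac_class (scale_fun s) L x" by (simp add: E.ac_class_iff E.null_0)
  ultimately show ?thesis using lift_fibre[OF u] by auto
qed

lemma mat_apply_basis: "b \<in> B \<Longrightarrow> mat_apply M (\<lambda>c. if c = b then 1 else 0) = M b"
proof
  fix c assume "b \<in> B"
  have "mat_apply M (\<lambda>c. if c = b then 1 else 0) c = (\<Sum>a\<in>B. if a = b then M a c else 0)"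
    unfolding mat_apply_def by (rule sum.cong) auto
  then show "mat_apply M (\<lambda>c. if c = b then 1 else 0) c = M b c"
    using \<open>b \<in> B\<close> finite_Basis by simp
qed

text \<open>Under \<open>fibre\<close> the image of the action corresponds to the row space of
  \<open>mat x\<close>. It is a line exactly if all rows are multiples of one nonzero vector and not
  all of them vanish.\<close>

lemma rank_eq_1_iff:
  assumes x: "Poly_Mapping.keys x \<subseteq> UNIV \<times> L"
  shows "rank_on (ac_extension s UNIV) (ac_action s (ac_class (scale_fun s) L x)) = 1 \<longleftrightarrow>
    (\<exists>\<alpha> w. (\<exists>b\<in>B. \<alpha> b \<noteq> 0) \<and> w \<noteq> 0 \<and> (\<forall>b\<in>B. mat x b = scale_fun (*) (\<alpha> b) w))"
proof -
  let ?T = "ac_action s (ac_class (scale_fun s) L x)" and ?V = "ac_extension s UNIV"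
  define E where "E = mat_apply (mat x) ` coords"
  have E_coords: "u \<in> coords" if "u \<in> E" for u
    using that by (auto simp: E_def coords_def mat_apply_def mat_outside)
  have row: "mat x b \<in> E" if "b \<in> B" for b
    unfolding E_def using mat_apply_basis[OF that, of "mat x"] that by (intro rev_image_eqI[of "\<lambda>c. if c = b then 1 else 0"]) (auto simp: coords_def)
  have rows: "mat_apply (mat x) u = (\<Sum>b\<in>B. scale_fun (*) (u b) (mat x b))" for u
    by (rule ext) (simp add: mat_apply_def scale_fun_def sum_apply)
  have "vectorspace.dim ring_of_type_algebra (?V\<lparr>carrier := ?T ` carrier ?V\<rparr>) = 1 \<longleftrightarrow>
    (\<exists>w\<in>E. w \<noteq> 0 \<and> (\<forall>u\<in>E. \<exists>a. u = scale_fun (*) a w))"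
  proof (rule dim_functions_eq_1_iff[where \<phi> = fibre and J = B and g = "mat x"])
    show "carrier (?V\<lparr>carrier := ?T ` carrier ?V\<rparr>) = fibre ` E"
      by (auto simp: carrier_V ac_action_fibre[OF x] E_def image_image)
    show "0 \<in> E"
      unfolding E_def by (rule rev_image_eqI[of 0]) (auto simp: coords_def mat_apply_def fun_eq_iff)
    show "u + v \<in> E" if uv: "u \<in> E" "v \<in> E" for u v
    proof -
      obtain u' v' where "u = mat_apply (mat x) u'" "v = mat_apply (mat x) v'" "u' \<in> coords" "v' \<in> coords"
        using uv unfolding E_def by blast
      then show ?thesis unfolding E_def
        by (intro rev_image_eqI[of "u' + v'"]) (auto simp: coords_def mat_apply_def fun_eq_iff sum.distrib algebra_simps)
    qed
    show "scale_fun (*) a u \<in> E" if u: "u \<in> E" for a u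
    proof -
      obtain u' where "u = mat_apply (mat x) u'" "u' \<in> coords" using u unfolding E_def by blast
      then show ?thesis unfolding E_def
        by (intro rev_image_eqI[of "scale_fun (*) a u'"])
          (auto simp: coords_def mat_apply_def fun_eq_iff scale_fun_def sum_distrib_left algebra_simps)
    qed
    show "inj_on fibre E" using inj_fibre E_coords by (meson inj_on_subset subsetI)
    show "\<exists>a. u = (\<Sum>b\<in>B. scale_fun (*) (a b) (mat x b))" if "u \<in> E" for u
      using that unfolding E_def rows by blast
  qed (use E_coords row finite_Basis in \<open>simp_all add: zero_V add_V smult_V\<close>)
  also have "\<dots> \<longleftrightarrow> (\<exists>\<alpha> w. (\<exists>b\<in>B. \<alpha> b \<noteq> 0) \<and> w \<noteq> 0 \<and> (\<forall>b\<in>B. mat x b = scale_fun (*) (\<alpha> b) w))"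
  proof
    assume "\<exists>w\<in>E. w \<noteq> 0 \<and> (\<forall>u\<in>E. \<exists>a. u = scale_fun (*) a w)"
    then obtain w where w: "w \<in> E" "w \<noteq> 0" "\<And>u. u \<in> E \<Longrightarrow> \<exists>a. u = scale_fun (*) a w" by blast
    have "\<forall>b. \<exists>a. b \<in> B \<longrightarrow> mat x b = scale_fun (*) a w" using w(3) row by blast
    then obtain \<alpha> where \<alpha>: "\<And>b. b \<in> B \<Longrightarrow> mat x b = scale_fun (*) (\<alpha> b) w" by metis
    have "\<exists>b\<in>B. \<alpha> b \<noteq> 0"
    proof (rule ccontr)
      assume "\<not> (\<exists>b\<in>B. \<alpha> b \<noteq> 0)"
      then have "mat_apply (mat x) u = 0" for u
        using \<alpha> by (auto simp: fun_eq_iff mat_apply_def scale_fun_def intro!: sum.neutral)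
      then show False using w(1,2) by (auto simp: E_def)
    qed
    then show "\<exists>\<alpha> w. (\<exists>b\<in>B. \<alpha> b \<noteq> 0) \<and> w \<noteq> 0 \<and> (\<forall>b\<in>B. mat x b = scale_fun (*) (\<alpha> b) w)"
      using w(2) \<alpha> by blast
  next
    assume "\<exists>\<alpha> w. (\<exists>b\<in>B. \<alpha> b \<noteq> 0) \<and> w \<noteq> 0 \<and> (\<forall>b\<in>B. mat x b = scale_fun (*) (\<alpha> b) w)"
    then obtain \<alpha> w b where w: "b \<in> B" "\<alpha> b \<noteq> 0" "w \<noteq> 0" and \<alpha>: "\<And>b. b \<in> B \<Longrightarrow> mat x b = scale_fun (*) (\<alpha> b) w"
      by blast
    \<comment> \<open>The generator is the row \<open>mat x b\<close> with
      \<open>\<alpha> b \<noteq> 0\<close>, which visibly lies in the row space; \<open>w\<close>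
      differs from it by the factor \<open>\<alpha> b\<close>.\<close>
    have "\<exists>a. u = scale_fun (*) a (mat x b)" if "u \<in> E" for u
    proof -
      obtain u' where u: "u = mat_apply (mat x) u'" using \<open>u \<in> E\<close> unfolding E_def by (elim imageE)
      have "u c = (\<Sum>a\<in>B. u' a * \<alpha> a) * w c" for c
        unfolding u mat_apply_def sum_distrib_right by (rule sum.cong) (simp_all add: \<alpha> scale_fun_def)
      then have "u = scale_fun (*) ((\<Sum>a\<in>B. u' a * \<alpha> a) / \<alpha> b) (mat x b)"
        using w(2) by (auto simp: fun_eq_iff scale_fun_def \<alpha>[OF w(1)])
      then show ?thesis by blast
    qed
    moreover have "mat x b \<noteq> 0"
      using w(2,3) by (auto simp: \<alpha>[OF w(1)] scale_fun_def fun_eq_iff)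
    ultimately show "\<exists>w\<in>E. w \<noteq> 0 \<and> (\<forall>u\<in>E. \<exists>a. u = scale_fun (*) a w)" using row[OF w(1)] by blast
  qed
  finally show ?thesis unfolding rank_on_def .
qed

end

section \<open>The dimension of the prolongation\<close>

text \<open>The kernel of one functional has codimension at most one in \<open>U\<close> and is
  separated by the remaining functionals. Induction spans the kernel, and at most one further vector
  spans \<open>U\<close>.\<close>

lemma (in vector_space) finite_span_of_functionals:
  assumes "finite F" and "subspace U"
    and "\<And>f x y. f \<in> F \<Longrightarrow> f (x + y) = f x + f y"
    and "\<And>f c x. f \<in> F \<Longrightarrow> f (c *s x) = c * f x"
    and "\<And>x. x \<in> U \<Longrightarrow> (\<And>f. f \<in> F \<Longrightarrow> f x = 0) \<Longrightarrow> x = 0"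
  shows "\<exists>B. finite B \<and> span B = U"
  using assms
proof (induction F arbitrary: U rule: finite_induct)
  case empty
  then have "U = {0}" using subspace_0[of U] by auto
  then show ?case by (intro exI[of _ "{}"]) auto
next
  case (insert f F)
  have add: "f (x + y) = f x + f y" and scale: "f (c *s x) = c * f x" for x y c
    using insert.prems(2,3) by auto
  have f0: "f 0 = 0" using scale[of 0 0] by simp
  define K where "K = {x\<in>U. f x = 0}"
  have "subspace K"
    using insert.prems(1) unfolding subspace_def K_def by (simp add: add scale f0)
  moreover have "x = 0" if "x \<in> K" "\<And>g. g \<in> F \<Longrightarrow> g x = 0" for x
    using that insert.prems(4)[of x] by (auto simp: K_def)
  ultimately obtain B where B: "finite B" "span B = K"
    using insert.IH[of K] insert.prems(2,3) by (metis insertCI)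
  show ?case
  proof (cases "K = U")
    case True
    then show ?thesis using B by blast
  next
    case False
    then obtain w where w: "w \<in> U" "f w \<noteq> 0" by (auto simp: K_def)
    have BU: "B \<subseteq> U" using span_superset[of B] B(2) by (auto simp: K_def)
    have "span (insert w B) = U"
    proof
      show "span (insert w B) \<subseteq> U"
        using BU w(1) insert.prems(1) by (intro span_minimal) auto
      show "U \<subseteq> span (insert w B)"
      proof
        fix x assume x: "x \<in> U"
        define y where "y = x + (- (f x / f w)) *s w"
        have "y \<in> U"
          unfolding y_def by (intro subspace_add subspace_scale insert.prems(1) x w(1))
        moreover have "f y = 0" unfolding y_def add scale using w(2) by simp
        ultimately have "y \<in> span (insert w B)"
          using B(2) span_mono[of B "insert w B"] by (auto simp: K_def)
        moreover have "x = y + (f x / f w) *s w" by (simp add: y_def)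
        ultimately show "x \<in> span (insert w B)"
          by (metis insertI1 span_add span_base span_scale)
      qed
    qed
    then show ?thesis using B(1) by blast
  qed
qed

lemma vector_space_prolongation_scale:
  "vector_space s \<Longrightarrow> vector_space (prolongation_scale s)"
  unfolding vector_space_def prolongation_scale_def scale_fun_def
  by (auto simp: fun_eq_iff)

lemma prolong_componentI:
  assumes "\<And>xs. length xs \<noteq> p + 1 \<Longrightarrow> \<xi> xs = 0"
    and "\<And>xs i. length xs = p + 1 \<Longrightarrow> i < p + 1 \<Longrightarrow> Vector_Spaces.linear s s (\<lambda>v. \<xi> (xs[i := v]))"
    and "\<And>xs ys. length xs = p + 1 \<Longrightarrow> mset xs = mset ys \<Longrightarrow> \<xi> xs = \<xi> ys"
    and "\<And>vs. length vs = p \<Longrightarrow> (\<lambda>v. \<xi> (vs @ [v])) \<in> L"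
  shows "\<xi> \<in> prolong_component s L p"
  unfolding prolong_component_def mem_Collect_eq by (intro conjI allI impI; (elim conjE)?; rule assms)

lemma prolong_componentD:
  assumes "\<xi> \<in> prolong_component s L p"
  shows "length xs \<noteq> p + 1 \<Longrightarrow> \<xi> xs = 0"
    and "length xs = p + 1 \<Longrightarrow> i < p + 1 \<Longrightarrow> Vector_Spaces.linear s s (\<lambda>v. \<xi> (xs[i := v]))"
    and "length xs = p + 1 \<Longrightarrow> mset xs = mset ys \<Longrightarrow> \<xi> xs = \<xi> ys"
    and "length vs = p \<Longrightarrow> (\<lambda>v. \<xi> (vs @ [v])) \<in> L"
proof -
  note c = assms[unfolded prolong_component_def mem_Collect_eq]
  show "length xs \<noteq> p + 1 \<Longrightarrow> \<xi> xs = 0" by (rule c[THEN conjunct1, rule_format])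
  show "length xs = p + 1 \<Longrightarrow> i < p + 1 \<Longrightarrow> Vector_Spaces.linear s s (\<lambda>v. \<xi> (xs[i := v]))"
    by (rule c[THEN conjunct2, THEN conjunct1, rule_format, OF conjI])
  show "length xs = p + 1 \<Longrightarrow> mset xs = mset ys \<Longrightarrow> \<xi> xs = \<xi> ys"
    by (rule c[THEN conjunct2, THEN conjunct2, THEN conjunct1, rule_format, OF conjI])
  show "length vs = p \<Longrightarrow> (\<lambda>v. \<xi> (vs @ [v])) \<in> L"
    by (rule c[THEN conjunct2, THEN conjunct2, THEN conjunct2, rule_format])
qed

context gl_subspace
begin

sublocale P: vector_space "prolongation_scale s"
  by (rule vector_space_prolongation_scale) (rule vector_space_axioms)

lemma prolong_component_zero: "0 \<in> prolong_component s L p"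
proof -
  interpret vector_space_pair s s by unfold_locales
  have "(\<lambda>v. 0) \<in> L" using E.subspace_0[OF L_subspace] by (simp add: zero_fun_def)
  then show ?thesis by (simp add: prolong_component_def linear_zero)
qed

text \<open>Each element has finitely many nonzero components, so a finite set spans nothing in some
  degree \<open>p\<close>, contrary to a nonzero component there.\<close>

lemma infinite_dimensional_prolongation:
  assumes "\<And>p. p \<ge> 1 \<Longrightarrow> prolong_component s L p \<noteq> {0}"
  shows "\<not> finite_dimensional (prolongation_scale s) (max_effective_prolongation s L)"
proof
  assume "finite_dimensional (prolongation_scale s) (max_effective_prolongation s L)"
  then obtain C where C: "finite C" "P.span C = max_effective_prolongation s L"
    unfolding finite_dimensional_def by blast
  have CP: "C \<subseteq> max_effective_prolongation s L" using P.span_superset[of C] C(2) by simp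
  have fin: "finite {p. snd (snd x) p \<noteq> 0}" if "x \<in> C" for x
    using that CP by (auto simp: max_effective_prolongation_def)
  obtain p where p: "p \<ge> 1" "\<And>x. x \<in> C \<Longrightarrow> snd (snd x) p = 0"
  proof -
    \<comment> \<open>Degree \<open>0\<close> is joined to the excluded degrees to force
      \<open>p \<ge> 1\<close>.\<close>
    have "finite ({0} \<union> (\<Union>x\<in>C. {p. snd (snd x) p \<noteq> 0}))" using C(1) fin by blast
    then obtain p where "p \<notin> {0} \<union> (\<Union>x\<in>C. {p. snd (snd x) p \<noteq> 0})"
      using infinite_UNIV_nat by (metis ex_new_if_finite)
    then show ?thesis by (intro that[of p]) auto
  qed
  have "P.subspace {x. snd (snd x) p = 0}"
    by (auto simp: P.subspace_def prolongation_scale_def scale_fun_def fun_eq_iff)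
  then have "P.span C \<subseteq> {x. snd (snd x) p = 0}" using p(2) by (intro P.span_minimal) auto
  moreover obtain \<xi> where \<xi>: "\<xi> \<in> prolong_component s L p" "\<xi> \<noteq> 0"
    using assms[OF p(1)] prolong_component_zero by blast
  have "(0, 0, \<lambda>q. if q = p then \<xi> else 0) \<in> max_effective_prolongation s L"
    using p(1) \<xi>(1) E.subspace_0[OF L_subspace]
    by (auto simp: max_effective_prolongation_def prolong_component_zero)
  ultimately show False using C(2) \<xi>(2) by auto
qed

lemma linear_eq_zero_of_basis:
  assumes f: "Vector_Spaces.linear s s f" and "\<And>b. b \<in> B \<Longrightarrow> f b = 0"
  shows "f v = 0"
proof (rule eq_of_crd)
  show "crd (f v) c = crd 0 c" for c
    using crd_linear[OF f, of v c] assms(2) by simp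
qed

text \<open>Arbitrary arguments are traded for basis vectors one slot at a time, by linearity in
  that slot.\<close>

lemma prolong_component_ext:
  assumes \<xi>: "\<xi> \<in> prolong_component s L p"
    and zero: "\<And>xs. length xs = p + 1 \<Longrightarrow> set xs \<subseteq> B \<Longrightarrow> \<xi> xs = 0"
  shows "\<xi> = 0"
proof
  fix xs
  \<comment> \<open>The first \<open>k\<close> arguments are arbitrary, the later ones are basis
    vectors.\<close>
  have "\<xi> xs = 0" if "length xs = p + 1" "k \<le> p + 1" "set (drop k xs) \<subseteq> B" for k xs
    using that
  proof (induction k arbitrary: xs)
    case 0
    then show ?case using zero by simp
  next
    case (Suc k)
    have k: "k < length xs" using Suc.prems by simp
    have "Vector_Spaces.linear s s (\<lambda>v. \<xi> (xs[k := v]))"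
      using prolong_componentD(2)[OF \<xi>] Suc.prems(1,2) by simp
    moreover have "\<xi> (xs[k := b]) = 0" if "b \<in> B" for b
      using that Suc.prems k by (intro Suc.IH) (auto simp: drop_update_swap Cons_nth_drop_Suc[symmetric])
    ultimately have "\<xi> (xs[k := xs ! k]) = 0" by (rule linear_eq_zero_of_basis)
    then show ?case by simp
  qed
  from this[of xs "p + 1"] show "\<xi> xs = 0 xs"
    using prolong_componentD(1)[OF \<xi>, of xs] by (cases "length xs = p + 1") auto
qed

lemma subspace_prolongation: "P.subspace (max_effective_prolongation s L)"
proof -
  interpret vector_space_pair s s by unfold_locales
  have add: "\<xi> + \<eta> \<in> prolong_component s L p"
    if \<xi>: "\<xi> \<in> prolong_component s L p" and \<eta>: "\<eta> \<in> prolong_component s L p" for \<xi> \<eta> p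
  proof (rule prolong_componentI)
    show "(\<lambda>v. (\<xi> + \<eta>) (vs @ [v])) \<in> L" if "length vs = p" for vs
      using E.subspace_add[OF L_subspace prolong_componentD(4)[OF \<xi> that] prolong_componentD(4)[OF \<eta> that]]
      by (simp add: plus_fun_def)
    show "Vector_Spaces.linear s s (\<lambda>v. (\<xi> + \<eta>) (xs[i := v]))" if "length xs = p + 1" "i < p + 1" for xs i
      using linear_compose_add[OF prolong_componentD(2)[OF \<xi> that] prolong_componentD(2)[OF \<eta> that]]
      by (simp add: plus_fun_def)
    show "(\<xi> + \<eta>) xs = (\<xi> + \<eta>) ys" if "length xs = p + 1" "mset xs = mset ys" for xs ys
      using prolong_componentD(3)[OF \<xi> that] prolong_componentD(3)[OF \<eta> that] by simp
  qed (simp add: prolong_componentD(1)[OF \<xi>] prolong_componentD(1)[OF \<eta>])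
  have scale: "scale_fun s c \<xi> \<in> prolong_component s L p"
    if \<xi>: "\<xi> \<in> prolong_component s L p" for \<xi> p c
  proof (rule prolong_componentI)
    show "(\<lambda>v. scale_fun s c \<xi> (vs @ [v])) \<in> L" if "length vs = p" for vs
      using E.subspace_scale[OF L_subspace prolong_componentD(4)[OF \<xi> that]] by (simp add: scale_fun_def)
    show "Vector_Spaces.linear s s (\<lambda>v. scale_fun s c \<xi> (xs[i := v]))" if "length xs = p + 1" "i < p + 1" for xs i
      unfolding scale_fun_def by (intro linear_compose_scale_right prolong_componentD(2)[OF \<xi> that])
    show "scale_fun s c \<xi> xs = scale_fun s c \<xi> ys" if "length xs = p + 1" "mset xs = mset ys" for xs ys
      using prolong_componentD(3)[OF \<xi> that] by (simp add: scale_fun_def)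
  qed (simp add: prolong_componentD(1)[OF \<xi>] scale_fun_def)
  have fin: "finite {p. (\<omega> + \<omega>') p \<noteq> 0}" if "finite {p. \<omega> p \<noteq> 0}" "finite {p. \<omega>' p \<noteq> 0}"
    for \<omega> \<omega>' :: "nat \<Rightarrow> 'v list \<Rightarrow> 'v"
    by (rule finite_subset[of _ "{p. \<omega> p \<noteq> 0} \<union> {p. \<omega>' p \<noteq> 0}"]) (use that in auto)
  have fin': "finite {p. scale_fun (scale_fun s) c \<omega> p \<noteq> 0}" if "finite {p. \<omega> p \<noteq> 0}"
    for \<omega> :: "nat \<Rightarrow> 'v list \<Rightarrow> 'v" and c
    by (rule finite_subset[of _ "{p. \<omega> p \<noteq> 0}"]) (use that in \<open>auto simp: scale_fun_def fun_eq_iff\<close>)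
  have "0 \<in> max_effective_prolongation s L"
    using E.subspace_0[OF L_subspace] prolong_component_zero
    by (simp add: max_effective_prolongation_def zero_prod_def)
  moreover have "x + y \<in> max_effective_prolongation s L"
    if "x \<in> max_effective_prolongation s L" "y \<in> max_effective_prolongation s L" for x y
    using that add fin E.subspace_add[OF L_subspace]
    by (auto simp: max_effective_prolongation_def)
  moreover have "prolongation_scale s c x \<in> max_effective_prolongation s L"
    if "x \<in> max_effective_prolongation s L" for x c
    using that scale fin' E.subspace_scale[OF L_subspace]
    by (auto simp: max_effective_prolongation_def prolongation_scale_def)
      (auto simp: scale_fun_def fun_eq_iff)
  ultimately show ?thesis by (simp add: P.subspace_def)
qed

text \<open>Below degree \<open>N\<close> an element is determined by finitely many coordinates:
  those of \<open>v\<close>, of \<open>A\<close> on basis vectors, and of each component on lists of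
  basis vectors. They form the separating family \<open>F\<close>.\<close>

lemma finite_dimensional_prolongation:
  assumes N: "\<And>p. p \<ge> N \<Longrightarrow> prolong_component s L p = {0}"
  shows "finite_dimensional (prolongation_scale s) (max_effective_prolongation s L)"
proof -
  define S where "S = (SIGMA p:{..<N}. {xs. set xs \<subseteq> B \<and> length xs = p + 1})"
  define F where "F = (\<lambda>c (v, A, \<omega>). representation B v c) ` B \<union>
    (\<lambda>(b, c) (v, A, \<omega>). representation B (A b) c) ` (B \<times> B) \<union>
    (\<lambda>((p, xs), c) (v, A, \<omega>). representation B (\<omega> p xs) c) ` (S \<times> B)"
  have r: "representation B (v + w) c = representation B v c + representation B w c"
    "representation B (s k v) c = k * representation B v c" for v w c k
    by (simp_all add: representation_add representation_scale independent_Basis span_Basis)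
  have z: "v = 0" if "\<And>c. c \<in> B \<Longrightarrow> representation B v c = 0" for v
    using that by (intro eq_of_crd) (metis crd_def crd_outside crd_zero to_ac_0)
  have "finite S"
    unfolding S_def by (intro finite_SigmaI finite_lists_length_eq finite_Basis) auto
  then have finF: "finite F"
    unfolding F_def by (intro finite_UnI finite_imageI finite_cartesian_product finite_Basis)
  have "x = 0" if x: "x \<in> max_effective_prolongation s L" and f: "\<And>f. f \<in> F \<Longrightarrow> f x = 0" for x
  proof -
    obtain v A \<omega> where x_eq: "x = (v, A, \<omega>)" by (cases x) auto
    have "representation B v c = 0" if "c \<in> B" for c
      using f[of "\<lambda>(v, A, \<omega>). representation B v c"] that by (auto simp: F_def x_eq)
    then have "v = 0" by (rule z)
    have "representation B (A b) c = 0" if "b \<in> B" "c \<in> B" for b c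
    proof -
      have "(b, c) \<in> B \<times> B" using that by simp
      then have "(\<lambda>(b, c) (v, A, \<omega>). representation B (A b) c) (b, c) \<in> F"
        unfolding F_def by blast
      from f[OF this] show ?thesis by (simp add: x_eq)
    qed
    then have "A b = 0" if "b \<in> B" for b using that by (intro z)
    moreover have "Vector_Spaces.linear s s A"
      using x by (auto simp: max_effective_prolongation_def x_eq intro: L_linear)
    ultimately have "A = 0" by (intro ext) (auto intro: linear_eq_zero_of_basis)
    have "\<omega> p = 0" for p
    proof (cases "p = 0 \<or> p \<ge> N")
      case True
      moreover have "\<omega> 0 = 0" and "p \<ge> 1 \<Longrightarrow> \<omega> p \<in> prolong_component s L p"
        using x by (auto simp: max_effective_prolongation_def x_eq)
      ultimately show ?thesis using N[of p] by (cases "p = 0") auto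
    next
      case False
      show ?thesis
      proof (rule prolong_component_ext)
        show "\<omega> p \<in> prolong_component s L p"
          using x False by (auto simp: max_effective_prolongation_def x_eq)
        show "\<omega> p xs = 0" if xs: "length xs = p + 1" "set xs \<subseteq> B" for xs
        proof (rule z)
          fix c assume "c \<in> B"
          then have "((p, xs), c) \<in> S \<times> B" using xs False by (auto simp: S_def)
          then have "(\<lambda>((p, xs), c) (v, A, \<omega>). representation B (\<omega> p xs) c) ((p, xs), c) \<in> F"
            unfolding F_def by blast
          from f[OF this] show "representation B (\<omega> p xs) c = 0" by (simp add: x_eq)
        qed
      qed
    qed
    then show ?thesis using \<open>v = 0\<close> \<open>A = 0\<close> by (simp add: x_eq zero_prod_def fun_eq_iff)
  qed
  moreover have "f (x + y) = f x + f y" if "f \<in> F" for f x y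
    using that by (cases x; cases y) (auto simp: F_def r)
  moreover have "f (prolongation_scale s c x) = c * f x" if "f \<in> F" for f x c
    using that by (cases x) (auto simp: F_def r prolongation_scale_def scale_fun_def)
  ultimately show ?thesis
    unfolding finite_dimensional_def
    using P.finite_span_of_functionals[OF finF subspace_prolongation] by blast
qed

end

section \<open>Nonzero components in every degree from a map of rank one\<close>

lemma ac_linear_functional_exists:
  "\<exists>\<phi> :: 'k::field alg_closure \<Rightarrow> 'k. Vector_Spaces.linear ac_scale (*) \<phi> \<and> \<phi> 1 = 1"
proof -
  interpret F: vector_space "ac_scale :: 'k \<Rightarrow> 'k alg_closure \<Rightarrow> 'k alg_closure"
    by unfold_locales (simp_all add: ac_scale_def algebra_simps)
  interpret K: vector_space "(*) :: 'k \<Rightarrow> 'k \<Rightarrow> 'k"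
    by unfold_locales (simp_all add: algebra_simps)
  interpret FK: vector_space_pair "ac_scale :: 'k \<Rightarrow> 'k alg_closure \<Rightarrow> 'k alg_closure" "(*) :: 'k \<Rightarrow> 'k \<Rightarrow> 'k"
    by unfold_locales
  \<comment> \<open>Over the ground field, the independent set \<open>{1}\<close> extends to a basis
    of the closure, so the value at \<open>1\<close> may be prescribed.\<close>
  have "F.independent {1}" by simp
  from FK.linear_independent_extend[OF this, of "\<lambda>_. 1"] show ?thesis by simp
qed

context gl_subspace
begin

lemma prolong_component_nonzero:
  assumes x: "Poly_Mapping.keys x \<subseteq> UNIV \<times> L"
    and rank: "\<And>b. b \<in> B \<Longrightarrow> mat x b = scale_fun (*) (\<alpha> b) w"
    and b: "b0 \<in> B" "\<alpha> b0 \<noteq> 0" and w: "w \<noteq> 0"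
  shows "prolong_component s L p \<noteq> {0}"
proof -
  obtain \<phi> :: "'k alg_closure \<Rightarrow> 'k" where \<phi>: "Vector_Spaces.linear ac_scale (*) \<phi>" "\<phi> 1 = 1"
    using ac_linear_functional_exists by blast
  have \<phi>_add: "\<phi> (f + g) = \<phi> f + \<phi> g" and \<phi>_scale: "\<phi> (to_ac k * f) = k * \<phi> f" for f g k
    using \<phi>(1) by (simp_all add: Vector_Spaces.linear_iff ac_scale_def)
  have \<phi>_0: "\<phi> 0 = 0" using \<phi>_scale[of 0 0] by simp
  have \<phi>_sum: "\<phi> (sum f A) = (\<Sum>a\<in>A. \<phi> (f a))" for f and A :: "('k alg_closure \<times> ('v \<Rightarrow> 'v)) set"
    by (induction A rule: infinite_finite_induct) (simp_all add: \<phi>_0 \<phi>_add)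
  obtain c0 where c0: "w c0 \<noteq> 0" using w by (auto simp: fun_eq_iff)
  \<comment> \<open>Matrix columns outside \<open>B\<close> vanish, so a nonzero coordinate of
    \<open>w\<close> has its index in \<open>B\<close>.\<close>
  have c0B: "c0 \<in> B"
    using mat_outside[of c0 x b0] rank[OF b(1)] b(2) c0 by (auto simp: scale_fun_def)
  \<comment> \<open>The form on \<open>V\<close> with values in the closure that extends
    \<open>\<alpha>\<close> linearly from the basis.\<close>
  define a where "a v = (\<Sum>b\<in>B. crd v b * \<alpha> b)" for v
  have a_add: "a (u + v) = a u + a v" and a_scale: "a (s k v) = to_ac k * a v" for u v k
    by (simp_all add: a_def sum.distrib sum_distrib_left algebra_simps)
  have a_b0: "a b0 = \<alpha> b0"
  proof -
    have "a b0 = (\<Sum>b\<in>B. if b = b0 then \<alpha> b else 0)"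
      unfolding a_def by (rule sum.cong) (use b(1) in \<open>auto simp: crd_basis\<close>)
    then show ?thesis using b(1) finite_Basis by simp
  qed
  \<comment> \<open>Both sides are coordinate \<open>c\<close> of the map represented by
    \<open>x\<close> at \<open>v\<close>: once by its rank-one form, once through the endomorphisms
    in \<open>x\<close>.\<close>
  have aw: "a v * w c = frag_eval (\<lambda>(f, A). f * crd (A v) c) x" for v c
  proof -
    have "a v * w c = (\<Sum>b\<in>B. crd v b * frag_eval (\<lambda>(f, A). f * crd (A b) c) x)"
      unfolding a_def sum_distrib_right
    proof (rule sum.cong)
      fix b assume "b \<in> B"
      then show "crd v b * \<alpha> b * w c = crd v b * frag_eval (\<lambda>(f, A). f * crd (A b) c) x"
        using fun_cong[OF rank[of b], of c] by (simp add: mat_def scale_fun_def)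
    qed simp
    also have "\<dots> = frag_eval (\<lambda>q. \<Sum>b\<in>B. crd v b * (case q of (f, A) \<Rightarrow> f * crd (A b) c)) x"
      by (simp add: frag_eval_sum_fun frag_eval_mult_left)
    also have "\<dots> = frag_eval (\<lambda>(f, A). f * crd (A v) c) x"
    proof (rule frag_eval_cong)
      fix q assume "q \<in> Poly_Mapping.keys x"
      then obtain f A where q: "q = (f, A)" "A \<in> L" using x by fastforce
      show "(\<Sum>b\<in>B. crd v b * (case q of (f, A) \<Rightarrow> f * crd (A b) c)) = (case q of (f, A) \<Rightarrow> f * crd (A v) c)"
        using crd_linear[OF L_linear[OF q(2)], of v c] by (simp add: q sum_distrib_left ac_simps)
    qed
    finally show ?thesis .
  qed
  \<comment> \<open>The rank-one map times \<open>t\<close>, brought back to \<open>V\<close> by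
    applying \<open>\<phi>\<close> to each coordinate.\<close>
  define val where "val t v = (\<Sum>c\<in>B. s (\<phi> (t * a v * w c)) c)" for t v
  have val_linear: "Vector_Spaces.linear s s (val t)" for t
    unfolding Vector_Spaces.linear_iff
  proof (intro conjI allI)
    show "val t (u + v) = val t u + val t v" for u v
      by (simp add: val_def a_add distrib_left distrib_right \<phi>_add scale_left_distrib sum.distrib)
    show "val t (s k v) = s k (val t v)" for k v
      using \<phi>_scale[of k "t * a v * w _"] by (simp add: val_def a_scale scale_sum_right ac_simps)
  qed (rule vector_space_axioms)+
  \<comment> \<open>The endomorphisms \<open>A\<close> in \<open>x\<close> have coordinates in the
    ground field, over which \<open>\<phi>\<close> is linear. So \<open>\<phi>\<close> acts on the
    coefficients alone, and \<open>val t\<close> is a combination of the \<open>A\<close> over the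
    ground field.\<close>
  have val_L: "val t \<in> L" for t
  proof -
    have "val t = (\<Sum>q\<in>Poly_Mapping.keys x.
        scale_fun s (\<phi> (t * of_int (poly_mapping.lookup x q) * fst q)) (snd q))" (is "_ = ?r")
    proof (rule ext, rule eq_of_crd)
      fix v c
      have "crd (val t v) c = (\<Sum>b\<in>B. if b = c then to_ac (\<phi> (t * a v * w b)) else 0)"
        unfolding val_def crd_sum by (rule sum.cong) (auto simp: crd_basis)
      also have "\<dots> = (if c \<in> B then to_ac (\<phi> (t * a v * w c)) else 0)"
        using finite_Basis by simp
      also have "\<phi> (t * a v * w c) = \<phi> (\<Sum>q\<in>Poly_Mapping.keys x.
          to_ac (representation B (snd q v) c) * (t * of_int (poly_mapping.lookup x q) * fst q))"
        by (simp add: mult.assoc aw) (simp add: frag_eval_def sum_distrib_left case_prod_unfold crd_def ac_simps)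
      also have "\<dots> = (\<Sum>q\<in>Poly_Mapping.keys x.
          representation B (snd q v) c * \<phi> (t * of_int (poly_mapping.lookup x q) * fst q))"
        by (simp only: \<phi>_sum \<phi>_scale)
      finally have "crd (val t v) c = (if c \<in> B then \<Sum>q\<in>Poly_Mapping.keys x.
          crd (snd q v) c * to_ac (\<phi> (t * of_int (poly_mapping.lookup x q) * fst q)) else 0)"
        by (simp add: to_ac_sum crd_def)
      also have "\<dots> = crd (?r v) c"
        by (simp add: sum_apply scale_fun_def crd_sum crd_outside ac_simps)
      finally show "crd (val t v) c = crd (?r v) c" .
    qed
    also have "\<dots> \<in> L"
      using x by (intro E.subspace_sum[OF L_subspace] E.subspace_scale[OF L_subspace]) auto
    finally show ?thesis .
  qed
  define t where "t = inverse (\<alpha> b0 ^ (p + 1) * w c0)"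
  \<comment> \<open>\<open>\<phi>\<close> applied to the coefficients of \<open>t \<alpha>\<^sup>p\<^sup>+\<^sup>1 \<otimes> w\<close>; the factor \<open>t\<close> normalizes one coefficient to \<open>1\<close>\<close>
  define \<xi> where "\<xi> xs = (if length xs = p + 1
    then \<Sum>c\<in>B. s (\<phi> (t * prod_mset (image_mset a (mset xs)) * w c)) c else 0)" for xs
  \<comment> \<open>With all arguments but \<open>v\<close> fixed, their forms merge into the scalar
    \<open>t\<close>. This gives both linearity in each slot and membership in
    \<open>L\<close>.\<close>
  have \<xi>_val: "\<xi> xs = val (t * prod_mset (image_mset a (mset xs - {#v#}))) v"
    if "length xs = p + 1" "v \<in> set xs" for xs v
  proof -
    have "mset xs = add_mset v (mset xs - {#v#})" using that(2) by simp
    then have "prod_mset (image_mset a (mset xs)) = a v * prod_mset (image_mset a (mset xs - {#v#}))"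
      by (metis image_mset_add_mset prod_mset.add_mset)
    then show ?thesis using that(1) by (simp add: \<xi>_def val_def ac_simps)
  qed
  have "\<xi> \<in> prolong_component s L p"
  proof (rule prolong_componentI)
    show "Vector_Spaces.linear s s (\<lambda>v. \<xi> (xs[i := v]))" if "length xs = p + 1" "i < p + 1" for xs i
    proof -
      have "\<xi> (xs[i := v]) = val (t * prod_mset (image_mset a (mset xs - {#xs ! i#}))) v" for v
        using \<xi>_val[of "xs[i := v]" v] that by (simp add: set_update_memI mset_update)
      then show ?thesis using val_linear by simp
    qed
    show "\<xi> xs = \<xi> ys" if "length xs = p + 1" "mset xs = mset ys" for xs ys
      using that mset_eq_length[OF that(2)] by (simp add: \<xi>_def)
    show "(\<lambda>v. \<xi> (vs @ [v])) \<in> L" if "length vs = p" for vs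
    proof -
      have "\<xi> (vs @ [v]) = val (t * prod_mset (image_mset a (mset vs))) v" for v
        using \<xi>_val[of "vs @ [v]" v] that by simp
      then have "(\<lambda>v. \<xi> (vs @ [v])) = val (t * prod_mset (image_mset a (mset vs)))" by (rule ext)
      then show ?thesis using val_L by simp
    qed
  qed (simp add: \<xi>_def)
  \<comment> \<open>By the choice of \<open>t\<close>, coordinate \<open>c0\<close> of this value is
    the image of \<open>\<phi> 1 = 1\<close>.\<close>
  moreover have "\<xi> (replicate (p + 1) b0) \<noteq> 0"
  proof
    let ?y = "\<xi> (replicate (p + 1) b0)"
    assume "?y = 0"
    have "?y = (\<Sum>c\<in>B. s (\<phi> (t * \<alpha> b0 ^ (p + 1) * w c)) c)"
      unfolding \<xi>_def by (simp add: a_b0)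
    then have "crd ?y c0 = (\<Sum>b\<in>B. if b = c0 then to_ac (\<phi> (t * \<alpha> b0 ^ (p + 1) * w b)) else 0)"
      unfolding crd_sum by (auto simp: crd_sum crd_basis intro: sum.cong)
    also have "\<dots> = to_ac (\<phi> (t * \<alpha> b0 ^ (p + 1) * w c0))" using c0B finite_Basis by simp
    also have "t * \<alpha> b0 ^ (p + 1) * w c0 = 1" using b(2) c0 by (simp add: t_def field_simps)
    finally show False using \<open>?y = 0\<close> \<phi>(2) by simp
  qed
  ultimately show ?thesis by auto
qed

end

section \<open>A map of rank one from an infinite dimensional prolongation\<close>

context gl_subspace
begin

text \<open>The extension of \<open>L\<close> to the algebraic closure, as a space of
  matrices.\<close>

definition matrices :: "('v \<Rightarrow> 'v \<Rightarrow> 'k alg_closure) set"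
  where "matrices = mat ` {x. Poly_Mapping.keys x \<subseteq> UNIV \<times> L}"

text \<open>The prolongations of \<open>\<bbbF> \<otimes> L\<close>, in coordinates: a symmetric \<open>m\<close>-linear map is given by its values
  on the multisets of \<open>m\<close> basis vectors.\<close>

definition sym :: "nat \<Rightarrow> ('v multiset \<Rightarrow> 'v \<Rightarrow> 'k alg_closure) set"
  where "sym m = {g. (\<forall>N. size N \<noteq> m \<or> \<not> set_mset N \<subseteq> B \<longrightarrow> g N = 0) \<and> (\<forall>N. g N \<in> coords) \<and>
    (\<forall>N. size N + 1 = m \<longrightarrow> (\<lambda>b. if b \<in> B then g (add_mset b N) else 0) \<in> matrices)}"

text \<open>Insertion of a basis vector into one argument. As the arguments form a multiset, the
  slot does not matter and the contractions commute.\<close>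

definition contract :: "'v \<Rightarrow> ('v multiset \<Rightarrow> 'v \<Rightarrow> 'k alg_closure) \<Rightarrow> 'v multiset \<Rightarrow> 'v \<Rightarrow> 'k alg_closure"
  where "contract b g N = g (add_mset b N)"

lemma symI:
  assumes "\<And>N. size N \<noteq> m \<or> \<not> set_mset N \<subseteq> B \<Longrightarrow> g N = 0" "\<And>N. g N \<in> coords"
    "\<And>N. size N + 1 = m \<Longrightarrow> (\<lambda>b. if b \<in> B then g (add_mset b N) else 0) \<in> matrices"
  shows "g \<in> sym m"
  unfolding sym_def using assms by blast

lemma symD:
  assumes "g \<in> sym m"
  shows "size N \<noteq> m \<or> \<not> set_mset N \<subseteq> B \<Longrightarrow> g N = 0" "g N \<in> coords"
    "size N + 1 = m \<Longrightarrow> (\<lambda>b. if b \<in> B then g (add_mset b N) else 0) \<in> matrices"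
  using assms unfolding sym_def by blast+

lemma matrices_zero: "0 \<in> matrices"
  unfolding matrices_def by (rule image_eqI[of _ _ 0]) (auto simp: mat_def fun_eq_iff)

lemma matrices_add: "M \<in> matrices \<Longrightarrow> M' \<in> matrices \<Longrightarrow> M + M' \<in> matrices"
proof -
  assume "M \<in> matrices" "M' \<in> matrices"
  then obtain x y where xy: "M = mat x" "M' = mat y" "Poly_Mapping.keys x \<subseteq> UNIV \<times> L" "Poly_Mapping.keys y \<subseteq> UNIV \<times> L"
    unfolding matrices_def by blast
  have "M + M' = mat (x + y)" unfolding xy by (auto simp: mat_def fun_eq_iff)
  moreover have "Poly_Mapping.keys (x + y) \<subseteq> UNIV \<times> L" using Poly_Mapping.keys_add[of x y] xy(3,4) by blast
  ultimately show ?thesis unfolding matrices_def by blast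
qed

lemma matrices_scale:
  assumes "M \<in> matrices"
  shows "scale_fun (scale_fun (*)) a M \<in> matrices"
proof -
  obtain x where x: "M = mat x" "Poly_Mapping.keys x \<subseteq> UNIV \<times> L"
    using assms unfolding matrices_def by blast
  let ?y = "frag_extend (\<lambda>(f, A). frag_of (a * f, A)) x"
  have "frag_eval (\<lambda>(f, A). f * crd (A b) c) ?y = a * frag_eval (\<lambda>(f, A). f * crd (A b) c) x" for b c
    unfolding frag_eval_extend frag_eval_mult_left[symmetric]
    by (rule frag_eval_cong) (auto simp: mult.assoc)
  then have "scale_fun (scale_fun (*)) a M = mat ?y"
    unfolding x by (auto simp: mat_def fun_eq_iff scale_fun_def)
  moreover have "Poly_Mapping.keys ?y \<subseteq> UNIV \<times> L"
    using x(2) keys_frag_extend[of "\<lambda>(f, A). frag_of (a * f, A)" x] by fastforce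
  ultimately show ?thesis unfolding matrices_def by blast
qed

lemma mat_in_matrices: "A \<in> L \<Longrightarrow> (\<lambda>b c. if b \<in> B then crd (A b) c else 0) \<in> matrices"
  unfolding matrices_def
  by (rule image_eqI[of _ _ "frag_of (1, A)"]) (auto simp: mat_def fun_eq_iff)

interpretation F: vector_space "scale_fun (scale_fun (*)) ::
    'k alg_closure \<Rightarrow> ('v multiset \<Rightarrow> 'v \<Rightarrow> 'k alg_closure) \<Rightarrow> _"
proof (intro vector_space_scale_fun)
  show "vector_space ((*) :: 'k alg_closure \<Rightarrow> _)" by unfold_locales (simp_all add: algebra_simps)
qed

lemma subspace_sym: "F.subspace (sym m)"
  unfolding F.subspace_def
proof (intro conjI ballI allI)
  show "0 \<in> sym m"
    using matrices_zero by (intro symI) (simp_all add: coords_def zero_fun_def cong: if_cong)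
  show "g + h \<in> sym m" if g: "g \<in> sym m" and h: "h \<in> sym m" for g h
  proof (rule symI)
    fix N :: "'v multiset" assume N: "size N + 1 = m"
    have "(\<lambda>b. if b \<in> B then (g + h) (add_mset b N) else 0) =
      (\<lambda>b. if b \<in> B then g (add_mset b N) else 0) + (\<lambda>b. if b \<in> B then h (add_mset b N) else 0)"
      by (rule ext) simp
    then show "(\<lambda>b. if b \<in> B then (g + h) (add_mset b N) else 0) \<in> matrices"
      using matrices_add[OF symD(3)[OF g N] symD(3)[OF h N]] by simp
  next
    show "(g + h) N = 0" if "size N \<noteq> m \<or> \<not> set_mset N \<subseteq> B" for N
      using symD(1)[OF g that] symD(1)[OF h that] by simp
    show "(g + h) N \<in> coords" for N
      using symD(2)[OF g, of N] symD(2)[OF h, of N] by (simp add: coords_def)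
  qed
  show "scale_fun (scale_fun (*)) a g \<in> sym m" if g: "g \<in> sym m" for a g
  proof (rule symI)
    fix N :: "'v multiset" assume N: "size N + 1 = m"
    have "(\<lambda>b. if b \<in> B then scale_fun (scale_fun (*)) a g (add_mset b N) else 0) =
      scale_fun (scale_fun (*)) a (\<lambda>b. if b \<in> B then g (add_mset b N) else 0)"
      by (auto simp: scale_fun_def fun_eq_iff)
    then show "(\<lambda>b. if b \<in> B then scale_fun (scale_fun (*)) a g (add_mset b N) else 0) \<in> matrices"
      using matrices_scale[OF symD(3)[OF g N]] by simp
  next
    show "scale_fun (scale_fun (*)) a g N = 0" if "size N \<noteq> m \<or> \<not> set_mset N \<subseteq> B" for N
      using symD(1)[OF g that] by (simp add: scale_fun_def fun_eq_iff)
    show "scale_fun (scale_fun (*)) a g N \<in> coords" for N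
      using symD(2)[OF g, of N] by (simp add: coords_def scale_fun_def)
  qed
qed

lemma finite_multisets: "finite {N. size N = m \<and> set_mset N \<subseteq> B}"
proof (rule finite_subset)
  show "finite (mset ` {xs. set xs \<subseteq> B \<and> length xs = m})"
    by (intro finite_imageI finite_lists_length_eq finite_Basis)
  show "{N. size N = m \<and> set_mset N \<subseteq> B} \<subseteq> mset ` {xs. set xs \<subseteq> B \<and> length xs = m}"
  proof
    fix N assume "N \<in> {N. size N = m \<and> set_mset N \<subseteq> B}"
    moreover obtain xs where "mset xs = N" using ex_mset by blast
    ultimately show "N \<in> mset ` {xs. set xs \<subseteq> B \<and> length xs = m}" by (intro image_eqI[of _ _ xs]) auto
  qed
qed

lemma finite_sym: "\<exists>C. finite C \<and> F.span C = sym m"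
proof (rule F.finite_span_of_functionals)
  let ?F = "(\<lambda>(N, c) (g :: 'v multiset \<Rightarrow> 'v \<Rightarrow> 'k alg_closure). g N c) ` ({N. size N = m \<and> set_mset N \<subseteq> B} \<times> B)"
  show "finite ?F" by (intro finite_imageI finite_cartesian_product finite_multisets finite_Basis)
  show "g = 0" if g: "g \<in> sym m" and z: "\<And>f. f \<in> ?F \<Longrightarrow> f g = 0" for g
  proof (intro ext)
    fix N c
    show "g N c = 0 N c"
    proof (cases "size N = m \<and> set_mset N \<subseteq> B \<and> c \<in> B")
      case True
      then have "(\<lambda>(N, c) g. g N c) (N, c) \<in> ?F" by (intro imageI) simp
      from z[OF this] show ?thesis by simp
    next
      case False
      then have "g N = 0 \<or> c \<notin> B" using symD(1)[OF g, of N] by blast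
      then show ?thesis using symD(2)[OF g, of N] by (auto simp: coords_def)
    qed
  qed
qed (auto simp: subspace_sym scale_fun_def)

lemma contract_sym:
  assumes g: "g \<in> sym (Suc m)" and b: "b \<in> B"
  shows "contract b g \<in> sym m"
proof (rule symI)
  show "contract b g N = 0" if "size N \<noteq> m \<or> \<not> set_mset N \<subseteq> B" for N
    unfolding contract_def by (rule symD(1)[OF g]) (use that in auto)
  show "contract b g N \<in> coords" for N
    unfolding contract_def by (rule symD(2)[OF g])
  show "(\<lambda>a. if a \<in> B then contract b g (add_mset a N) else 0) \<in> matrices" if "size N + 1 = m" for N
    using symD(3)[OF g, of "add_mset b N"] that by (simp add: contract_def add_mset_commute cong: if_cong)
qed

lemma contract_effective:
  assumes g: "g \<in> sym (Suc m)" and zero: "\<And>b. b \<in> B \<Longrightarrow> contract b g = 0"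
  shows "g = 0"
proof
  fix N
  show "g N = 0 N"
  proof (cases "size N = Suc m \<and> set_mset N \<subseteq> B")
    case True
    then obtain b N' where N: "N = add_mset b N'" by (metis size_eq_Suc_imp_eq_union)
    then have "contract b g N' = 0" using zero[of b] True by simp
    then show ?thesis by (simp add: contract_def N)
  next
    case False
    then show ?thesis using symD(1)[OF g, of N] by auto
  qed
qed

text \<open>The map is recorded by its values on basis vectors, which determine it. Degree
  \<open>p\<close> of the prolongation goes to \<open>sym (p + 1)\<close>, because
  \<open>sym\<close> counts arguments.\<close>

lemma sym_nonzero_of_prolong:
  assumes "\<xi> \<in> prolong_component s L p" "\<xi> \<noteq> 0"
  shows "\<exists>g\<in>sym (p + 1). g \<noteq> 0"
proof -
  note \<xi> = prolong_componentD[OF assms(1)]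
  \<comment> \<open>An arbitrary ordering of the multiset; symmetry of \<open>\<xi>\<close> makes
    its values independent of the choice.\<close>
  define lst where "lst N = (SOME xs. mset xs = N)" for N :: "'v multiset"
  have lst: "mset (lst N) = N" for N unfolding lst_def by (rule someI_ex) (rule ex_mset)
  define g where "g N = (if size N = p + 1 \<and> set_mset N \<subseteq> B then crd (\<xi> (lst N)) else 0)" for N
  have g_mset: "g (mset xs) = crd (\<xi> xs)" if "length xs = p + 1" "set xs \<subseteq> B" for xs
    using that \<xi>(3)[OF that(1), of "lst (mset xs)"] by (simp add: g_def lst)
  have "g \<in> sym (p + 1)"
  proof (rule symI)
    show "g N = 0" if "size N \<noteq> p + 1 \<or> \<not> set_mset N \<subseteq> B" for N using that by (auto simp: g_def)
    show "g N \<in> coords" for N by (auto simp: g_def coords_def crd_outside)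
    show "(\<lambda>b. if b \<in> B then g (add_mset b N) else 0) \<in> matrices" if N: "size N + 1 = p + 1" for N
    proof (cases "set_mset N \<subseteq> B")
      case True
      obtain vs where vs: "mset vs = N" using ex_mset by blast
      then have len: "length vs = p" "set vs \<subseteq> B" using N True by auto
      have "(if b \<in> B then g (add_mset b N) else 0) = (\<lambda>c. if b \<in> B then crd (\<xi> (vs @ [b])) c else 0)" for b
        using g_mset[of "vs @ [b]"] len vs by (auto simp: fun_eq_iff)
      then show ?thesis using mat_in_matrices[OF \<xi>(4)[OF len(1)]] by simp
    next
      case False
      then have "(\<lambda>b. if b \<in> B then g (add_mset b N) else 0) = 0" by (auto simp: g_def fun_eq_iff)
      then show ?thesis using matrices_zero by simp
    qed
  qed
  moreover have "g \<noteq> 0"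
  proof
    assume g0: "g = 0"
    have "\<xi> xs = 0" if "length xs = p + 1" "set xs \<subseteq> B" for xs
      using g_mset[OF that] g0 by (intro eq_of_crd) (simp add: fun_eq_iff)
    then show False using prolong_component_ext[OF assms(1)] assms(2) by blast
  qed
  ultimately show ?thesis by blast
qed

lemma rank_one_of_infinite:
  assumes inf: "\<not> finite_dimensional (prolongation_scale s) (max_effective_prolongation s L)"
  shows "\<exists>x \<alpha> w. Poly_Mapping.keys x \<subseteq> UNIV \<times> L \<and> (\<exists>b\<in>B. \<alpha> b \<noteq> 0) \<and> w \<noteq> 0 \<and>
    (\<forall>b\<in>B. mat x b = scale_fun (*) (\<alpha> b) w)"
proof -
  \<comment> \<open>One vanishing degree would make all higher ones vanish, and with them all
    components of the prolongation from degree \<open>m\<close> on, so its dimension would be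
    finite.\<close>
  have nonzero: "sym m \<noteq> {0}" for m
  proof
    assume "sym m = {0}"
    then have z: "sym n \<subseteq> {0}" if "m \<le> n" for n
      using graded_zero_up[of sym B contract m n] contract_sym contract_effective that by blast
    have "prolong_component s L p = {0}" if "p \<ge> m" for p
      using sym_nonzero_of_prolong[of _ p] z[of "p + 1"] that prolong_component_zero[of p] by fastforce
    then show False using finite_dimensional_prolongation[of m] inf by blast
  qed
  interpret G: graded_system "scale_fun (scale_fun (*)) :: 'k alg_closure \<Rightarrow>
      ('v multiset \<Rightarrow> 'v \<Rightarrow> 'k alg_closure) \<Rightarrow> _" B contract sym
  proof (rule graded_system.intro, rule F.vector_space_axioms, rule graded_system_axioms.intro)
    show "Vector_Spaces.linear (scale_fun (scale_fun (*))) (scale_fun (scale_fun (*))) (contract b)" if "b \<in> B" for b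
      unfolding Vector_Spaces.linear_iff using F.vector_space_axioms
      by (simp add: contract_def scale_fun_def fun_eq_iff)
    show "\<exists>C. finite C \<and> sym m \<subseteq> F.span C" for m
      using finite_sym[of m] by (metis order_refl)
    show "contract a (contract b g) = contract b (contract a g)" if "a \<in> B" "b \<in> B" for a b g
      by (simp add: contract_def fun_eq_iff add_mset_commute)
  qed (fact subspace_sym nonzero contract_sym | rule contract_effective; assumption)+
  obtain u w l where u: "u \<in> sym 1" "w \<in> sym 0" "w \<noteq> 0" "\<exists>b\<in>B. l b \<noteq> 0"
    and l: "\<And>b. b \<in> B \<Longrightarrow> contract b u = scale_fun (scale_fun (*)) (l b) w"
    using G.common_eigenvector by blast
  \<comment> \<open>In degree one \<open>u\<close> is a matrix of the extension of \<open>L\<close>,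
    and its row at \<open>b\<close> is \<open>contract b u {#}\<close>. Proportional contractions
    therefore mean proportional rows.\<close>
  obtain x where x: "Poly_Mapping.keys x \<subseteq> UNIV \<times> L" "(\<lambda>b. if b \<in> B then u (add_mset b {#}) else 0) = mat x"
    using symD(3)[OF u(1), of "{#}"] by (auto simp: matrices_def)
  have "mat x b = scale_fun (*) (l b) (w {#})" if "b \<in> B" for b
    using fun_cong[OF l[OF that], of "{#}"] that by (simp add: x(2)[symmetric] contract_def scale_fun_def)
  \<comment> \<open>An element of \<open>sym 0\<close> is supported on the empty multiset, so it is
    nonzero only if its value there is.\<close>
  moreover have "w {#} \<noteq> 0"
  proof
    assume "w {#} = 0"
    then have "w N = 0" for N using symD(1)[OF u(2), of N] by (cases "N = {#}") auto
    then show False using u(3) by auto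
  qed
  ultimately show ?thesis using x(1) u(4) by blast
qed

theorem infinite_dimensional_iff_rank_one:
  "\<not> finite_dimensional (prolongation_scale s) (max_effective_prolongation s L) \<longleftrightarrow>
    (\<exists>\<theta>\<in>carrier (ac_extension (scale_fun s) L). rank_on (ac_extension s UNIV) (ac_action s \<theta>) = 1)"
proof -
  have "\<not> finite_dimensional (prolongation_scale s) (max_effective_prolongation s L) \<longleftrightarrow>
    (\<exists>x \<alpha> w. Poly_Mapping.keys x \<subseteq> UNIV \<times> L \<and> (\<exists>b\<in>B. \<alpha> b \<noteq> 0) \<and> w \<noteq> 0 \<and>
      (\<forall>b\<in>B. mat x b = scale_fun (*) (\<alpha> b) w))"
    (is "_ \<longleftrightarrow> ?rank1")
  proof
    assume ?rank1
    then obtain x \<alpha> w b where "Poly_Mapping.keys x \<subseteq> UNIV \<times> L" "b \<in> B" "\<alpha> b \<noteq> 0" "w \<noteq> 0"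
      and "\<And>b. b \<in> B \<Longrightarrow> mat x b = scale_fun (*) (\<alpha> b) w"
      by blast
    then show "\<not> finite_dimensional (prolongation_scale s) (max_effective_prolongation s L)"
      by (intro infinite_dimensional_prolongation prolong_component_nonzero)
  qed (rule rank_one_of_infinite)
  also have "\<dots> \<longleftrightarrow> (\<exists>\<theta>\<in>carrier (ac_extension (scale_fun s) L).
      rank_on (ac_extension s UNIV) (ac_action s \<theta>) = 1)"
    \<comment> \<open>Every element of the extension is the class of a formal sum with keys in
      \<open>UNIV \<times> L\<close>, to which the rank criterion applies.\<close>
    unfolding E.carrier_ac_extension using rank_eq_1_iff by auto
  finally show ?thesis .
qed

end

theorem theorem3p11:
  fixes s :: "'k::field_char_0 \<Rightarrow> 'v::ab_group_add \<Rightarrow> 'v"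
    and \<aa>\<^sub>0 :: "('v \<Rightarrow> 'v) set"
  assumes "vector_space s"
    and "finite_dimensional s UNIV"
    and "lie_subalgebra_gl s \<aa>\<^sub>0"
  shows "\<not> finite_dimensional (prolongation_scale s) (max_effective_prolongation s \<aa>\<^sub>0) \<longleftrightarrow>
    (\<exists>\<theta>\<in>carrier (ac_extension (scale_fun s) \<aa>\<^sub>0). rank_on (ac_extension s UNIV) (ac_action s \<theta>) = 1)"
proof -
  interpret vector_space s by fact
  obtain C where C: "finite C" "span C = UNIV"
    using assms(2) unfolding finite_dimensional_def by blast
  \<comment> \<open>Coordinates refer to a fixed basis; it is finite because the finite set
    \<open>C\<close> spans.\<close>
  obtain B where B: "independent B" "UNIV \<subseteq> span B"
    using maximal_independent_subset[of UNIV] by blast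
  have "finite B" using independent_span_bound[OF C(1) B(1)] C(2) by simp
  then interpret gl_subspace s B \<aa>\<^sub>0
    using B assms(3) by unfold_locales (auto simp: lie_subalgebra_gl_def)
  show ?thesis by (rule infinite_dimensional_iff_rank_one)
qed


end
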